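(* For real parameters $(\xi,\mu,\kappa,\eta)$ with $\xi>1$ consider the center unstable Hénon-like family of maps $G_{\xi,\mu,\kappa,\eta}:\mathbb{R}^3\to\mathbb{R}^3$, $$G_{\xi,\mu,\kappa,\eta}(x,y,z)=(\xi x+y,\ \mu+y^2+\kappa x^2+\eta xy,\ y).$$ Let $r\ge 1$. There is a nonempty open set $\mathcal{B}$ of parameters $(\xi,\mu,\kappa,\eta)$ (with $\xi>1$) such that any diffeomorphism $F$ that is $C^r$-close to $G_{\xi,\mu,\kappa,\eta}$ with $(\xi,\mu,\kappa,\eta)\in\mathcal{B}$ has a blender.
   Context: The maps $G_{\xi,\mu,\kappa,\eta}$ are non-invertible. "$F$ is $C^r$-close to $G$" means: for each parameter in $\mathcal{B}$ there are a compact set of $\mathbb{R}^3$ and a neighborhood of $G$ in the $C^r$ topology on that compact set such that the conclusion holds for all diffeomorphisms $F$ of $\mathbb{R}^3$ in that neighborhood. The index of a hyperbolic set is the dimension of its unstable bundle. Blender ($cu$-blender): let $f:M\to M$ be a diffeomorphism. A transitive hyperbolic compact set $\Lambda$ of $f$ of index $k\ge 2$ is a $cu$-blender (blender) if there are a $C^1$-neighborhood $\mathcal{U}$ of $f$ and a (nonempty) $C^1$-open set $\mathcal{D}$ of embeddings of $(k-1)$-dimensional disks $D$ into $M$ such that for every $g\in\mathcal{U}$ and every $D\in\mathcal{D}$ the local stable manifold $W^s_{\mathrm{loc}}(\Lambda_g)$ of the hyperbolic continuation $\Lambda_g$ of $\Lambda$ for $g$ intersects $D$. *)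

theory Defs
  imports "HOL-Analysis.Analysis"
begin

primrec iter_deriv :: "'a list \<Rightarrow> ('a::real_normed_vector \<Rightarrow> 'b::real_normed_vector) \<Rightarrow> 'a \<Rightarrow> 'b" where
  "iter_deriv [] f = f"
| "iter_deriv (v # vs) f = iter_deriv vs (\<lambda>x. frechet_derivative f (at x) v)"

definition Cr_map :: "nat \<Rightarrow> ('a::euclidean_space \<Rightarrow> 'b::euclidean_space) \<Rightarrow> bool" where
  "Cr_map r f \<longleftrightarrow>
     (\<forall>vs\<in>lists Basis. length vs < r \<longrightarrow> (\<forall>x. iter_deriv vs f differentiable (at x))) \<and>
     (\<forall>vs\<in>lists Basis. length vs \<le> r \<longrightarrow> continuous_on UNIV (iter_deriv vs f))"

definition Cr_diffeo :: "nat \<Rightarrow> ('a::euclidean_space \<Rightarrow> 'a) \<Rightarrow> bool" where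
  "Cr_diffeo r f \<longleftrightarrow> bij f \<and> Cr_map r f \<and> Cr_map r (inv f)"

definition Cr_close ::
  "nat \<Rightarrow> 'a set \<Rightarrow> real \<Rightarrow> ('a::euclidean_space \<Rightarrow> 'b::euclidean_space) \<Rightarrow> ('a \<Rightarrow> 'b) \<Rightarrow> bool" where
  "Cr_close r K e f g \<longleftrightarrow>
     (\<forall>x\<in>K. \<forall>vs\<in>lists Basis. length vs \<le> r \<longrightarrow> norm (iter_deriv vs f x - iter_deriv vs g x) < e)"

text \<open>Neighborhoods of \<open>f\<close> in the space of \<open>C\<^sup>1\<close> diffeomorphisms, with the topology of
  \<open>C\<^sup>1\<close> convergence on compact sets.\<close>

definition C1_nhd :: "('a::euclidean_space \<Rightarrow> 'a) \<Rightarrow> ('a \<Rightarrow> 'a) set \<Rightarrow> bool" where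
  "C1_nhd f U \<longleftrightarrow>
     U \<subseteq> Collect (Cr_diffeo 1) \<and>
     (\<exists>K e. compact K \<and> e > 0 \<and> (\<forall>g. Cr_diffeo 1 g \<and> Cr_close 1 K e g f \<longrightarrow> g \<in> U))"

text \<open>The standard closed disk of dimension \<open>DIM('d)\<close> is \<open>cball 0 1\<close>; a disk in \<open>'a\<close> is a map
  on \<open>'d\<close> of which only the restriction to \<open>cball 0 1\<close> matters. Derivatives within \<open>cball 0 1\<close>
  are unique, also at boundary points.\<close>

definition disk_deriv :: "('d::euclidean_space \<Rightarrow> 'a::euclidean_space) \<Rightarrow> 'd \<Rightarrow> 'd \<Rightarrow> 'a" where
  "disk_deriv \<phi> x = frechet_derivative \<phi> (at x within cball 0 1)"

definition C1_disk_embedding :: "('d::euclidean_space \<Rightarrow> 'a::euclidean_space) \<Rightarrow> bool" where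
  "C1_disk_embedding \<phi> \<longleftrightarrow>
     inj_on \<phi> (cball 0 1) \<and>
     (\<forall>x\<in>cball 0 1. \<phi> differentiable (at x within cball 0 1) \<and> inj (disk_deriv \<phi> x)) \<and>
     (\<forall>v\<in>Basis. continuous_on (cball 0 1) (\<lambda>x. disk_deriv \<phi> x v))"

definition C1_disk_close ::
  "real \<Rightarrow> ('d::euclidean_space \<Rightarrow> 'a::euclidean_space) \<Rightarrow> ('d \<Rightarrow> 'a) \<Rightarrow> bool" where
  "C1_disk_close e \<phi> \<psi> \<longleftrightarrow>
     (\<forall>x\<in>cball 0 1. norm (\<phi> x - \<psi> x) < e \<and>
        (\<forall>v\<in>Basis. norm (disk_deriv \<phi> x v - disk_deriv \<psi> x v) < e))"

definition C1_open_disks :: "('d::euclidean_space \<Rightarrow> 'a::euclidean_space) set \<Rightarrow> bool" where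
  "C1_open_disks \<D> \<longleftrightarrow>
     \<D> \<subseteq> Collect C1_disk_embedding \<and>
     (\<forall>\<phi>\<in>\<D>. \<exists>e>0. \<forall>\<psi>. C1_disk_embedding \<psi> \<and> C1_disk_close e \<psi> \<phi> \<longrightarrow> \<psi> \<in> \<D>)"

definition hyperbolic_splitting ::
  "('a::euclidean_space \<Rightarrow> 'a) \<Rightarrow> 'a set \<Rightarrow> ('a \<Rightarrow> 'a set) \<Rightarrow> ('a \<Rightarrow> 'a set) \<Rightarrow> bool" where
  "hyperbolic_splitting f \<Lambda> Es Eu \<longleftrightarrow>
     (\<forall>x\<in>\<Lambda>. subspace (Es x) \<and> subspace (Eu x) \<and>
        Es x \<inter> Eu x = {0} \<and> {a + b | a b. a \<in> Es x \<and> b \<in> Eu x} = UNIV \<and>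
        frechet_derivative f (at x) ` Es x = Es (f x) \<and>
        frechet_derivative f (at x) ` Eu x = Eu (f x)) \<and>
     (\<exists>C \<theta>. 0 < C \<and> 0 < \<theta> \<and> \<theta> < 1 \<and>
        (\<forall>x\<in>\<Lambda>. \<forall>n.
           (\<forall>v\<in>Es x. norm (frechet_derivative (f ^^ n) (at x) v) \<le> C * \<theta> ^ n * norm v) \<and>
           (\<forall>v\<in>Eu x. norm (frechet_derivative (inv f ^^ n) (at x) v) \<le> C * \<theta> ^ n * norm v)))"

definition hyperbolic_set :: "('a::euclidean_space \<Rightarrow> 'a) \<Rightarrow> 'a set \<Rightarrow> bool" where
  "hyperbolic_set f \<Lambda> \<longleftrightarrow>
     compact \<Lambda> \<and> f ` \<Lambda> = \<Lambda> \<and> (\<exists>Es Eu. hyperbolic_splitting f \<Lambda> Es Eu)"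

definition has_index :: "('a::euclidean_space \<Rightarrow> 'a) \<Rightarrow> 'a set \<Rightarrow> nat \<Rightarrow> bool" where
  "has_index f \<Lambda> k \<longleftrightarrow>
     (\<exists>Es Eu. hyperbolic_splitting f \<Lambda> Es Eu \<and> (\<forall>x\<in>\<Lambda>. dim (Eu x) = k))"

definition transitive_set :: "('a::euclidean_space \<Rightarrow> 'a) \<Rightarrow> 'a set \<Rightarrow> bool" where
  "transitive_set f \<Lambda> \<longleftrightarrow> (\<exists>x\<in>\<Lambda>. closure (range (\<lambda>n. (f ^^ n) x)) = \<Lambda>)"

text \<open>\<open>\<Lambda>'\<close> is the image of \<open>\<Lambda>\<close> under a topological conjugacy from \<open>f\<close> to \<open>g\<close> that is
  \<open>d\<close>-close to the identity.\<close>

definition conjugate_copy ::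
  "real \<Rightarrow> ('a::euclidean_space \<Rightarrow> 'a) \<Rightarrow> 'a set \<Rightarrow> ('a \<Rightarrow> 'a) \<Rightarrow> 'a set \<Rightarrow> bool" where
  "conjugate_copy d f \<Lambda> g \<Lambda>' \<longleftrightarrow>
     (\<exists>h h'. homeomorphism \<Lambda> \<Lambda>' h h' \<and> (\<forall>x\<in>\<Lambda>. dist (h x) x \<le> d \<and> h (f x) = g (h x)))"

text \<open>\<open>L g\<close> is the hyperbolic continuation of \<open>\<Lambda>\<close> for each \<open>g \<in> U\<close>: the only conjugate copy of
  \<open>\<Lambda>\<close> at some distance \<open>d\<close> that does not depend on \<open>g\<close>. Since \<open>\<Lambda>\<close> itself is such a
  copy for \<open>g = f\<close>, uniqueness forces \<open>L f = \<Lambda>\<close> when \<open>f \<in> U\<close>.\<close>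

definition hyperbolic_continuation ::
  "('a::euclidean_space \<Rightarrow> 'a) \<Rightarrow> 'a set \<Rightarrow> ('a \<Rightarrow> 'a) set \<Rightarrow> (('a \<Rightarrow> 'a) \<Rightarrow> 'a set) \<Rightarrow> bool" where
  "hyperbolic_continuation f \<Lambda> U L \<longleftrightarrow>
     (\<exists>d>0. \<forall>g\<in>U. hyperbolic_set g (L g) \<and> conjugate_copy d f \<Lambda> g (L g) \<and>
        (\<forall>\<Lambda>'. conjugate_copy d f \<Lambda> g \<Lambda>' \<longrightarrow> \<Lambda>' = L g))"

definition stable_at :: "('a::euclidean_space \<Rightarrow> 'a) \<Rightarrow> real \<Rightarrow> 'a \<Rightarrow> 'a set" where
  "stable_at g e x = {y. \<forall>n. dist ((g ^^ n) x) ((g ^^ n) y) \<le> e}"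

definition local_stable :: "('a::euclidean_space \<Rightarrow> 'a) \<Rightarrow> real \<Rightarrow> 'a set \<Rightarrow> 'a set" where
  "local_stable g e \<Lambda> = (\<Union>x\<in>\<Lambda>. stable_at g e x)"

text \<open>\<open>stable_at g e x\<close> is a local stable manifold only for small sizes \<open>e\<close>. The next predicate
  says that \<open>e\<close> is small enough: orbits that stay \<open>e\<close>-close converge uniformly exponentially.\<close>

definition stable_size :: "('a::euclidean_space \<Rightarrow> 'a) \<Rightarrow> real \<Rightarrow> 'a set \<Rightarrow> bool" where
  "stable_size g e \<Lambda> \<longleftrightarrow> 0 < e \<and>
     (\<exists>C \<theta>. 0 < C \<and> 0 < \<theta> \<and> \<theta> < 1 \<and>
        (\<forall>x\<in>\<Lambda>. \<forall>y\<in>stable_at g e x. \<forall>n.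
           dist ((g ^^ n) x) ((g ^^ n) y) \<le> C * \<theta> ^ n * dist x y))"

text \<open>The index is \<open>k = DIM('d) + 1 \<ge> 2\<close>, so that disks modelled on \<open>'d\<close> have dimension
  \<open>k - 1\<close>. The size \<open>e\<close> of the local stable manifolds is the same for all \<open>g \<in> U\<close>.\<close>

definition cu_blender ::
  "'d::euclidean_space itself \<Rightarrow> ('a::euclidean_space \<Rightarrow> 'a) \<Rightarrow> 'a set \<Rightarrow> bool" where
  "cu_blender _ f \<Lambda> \<longleftrightarrow>
     Cr_diffeo 1 f \<and> hyperbolic_set f \<Lambda> \<and> transitive_set f \<Lambda> \<and> has_index f \<Lambda> (DIM('d) + 1) \<and>
     (\<exists>U L e (\<D> :: ('d \<Rightarrow> 'a) set).
        C1_nhd f U \<and> hyperbolic_continuation f \<Lambda> U L \<and>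
        C1_open_disks \<D> \<and> \<D> \<noteq> {} \<and>
        (\<forall>g\<in>U. stable_size g e (L g) \<and>
           (\<forall>\<phi>\<in>\<D>. local_stable g e (L g) \<inter> \<phi> ` cball 0 1 \<noteq> {})))"

text \<open>In dimension 3 the index is at most 3, so the disks have dimension 1 or 2.\<close>

definition has_blender :: "(real^3 \<Rightarrow> real^3) \<Rightarrow> bool" where
  "has_blender f \<longleftrightarrow>
     (\<exists>\<Lambda>. cu_blender TYPE(real) f \<Lambda>) \<or> (\<exists>\<Lambda>. cu_blender TYPE(real^2) f \<Lambda>)"

definition cu_henon :: "real \<Rightarrow> real \<Rightarrow> real \<Rightarrow> real \<Rightarrow> real^3 \<Rightarrow> real^3" where
  "cu_henon \<xi> \<mu> \<kappa> \<eta> p =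
     (let x = p $ 1; y = p $ 2
      in vector [\<xi> * x + y, \<mu> + y\<^sup>2 + \<kappa> * x\<^sup>2 + \<eta> * x * y, y])"

end

theory Submission
  imports Defs "HOL-Library.Discrete_Functions"
begin

text \<open>
  The parameters are taken near \<open>\<xi> = 3/2\<close>, \<open>\<mu> = -100\<close>, \<open>\<kappa> = \<eta> = 0\<close>. There the map is
  \<open>(x, y, z) \<mapsto> (3/2 x + y, y\<^sup>2 - 100, y)\<close>. In \<open>y\<close> it is a quadratic map with a full horseshoe: the
  thin strips around \<open>y = 10\<close> and \<open>y = -10\<close> are each stretched by a factor of about 20 over an
  interval that contains both strips. In \<open>x\<close> the two strips act approximately as the weak
  expansions \<open>x \<mapsto> 3/2 x + 10\<close> and \<open>x \<mapsto> 3/2 x - 10\<close>. In \<open>z\<close> everything is forgotten.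
  Hence the orbits that stay near the two strips form a hyperbolic set with two unstable directions
  \<open>x, y\<close> and one stable direction close to \<open>z\<close>, on which the dynamics is the full shift on two
  symbols. All of this survives a perturbation that is small in the \<open>C\<^sup>1\<close> sense on one large
  ball, and the constants do not depend on the perturbation. The maps in such a fixed neighborhood of
  the base map serve at once as the diffeomorphisms of the theorem and as the neighborhood that the
  definition of a blender requires.

  Two tools do the work. The first is an existence result for orbits
  (\<open>shadowing_orbit\<close>): solving the equation of an orbit for the coordinates \<open>x, y\<close> backwards in
  time and for \<open>z\<close> forwards in time gives a contraction on bounded two-sided sequences. It yields a
  point for every itinerary, it yields orbits of a map near the orbits of a neighboring map, and,
  applied to the derivatives with one inhomogeneous term, it splits every vector into a part with
  bounded forward orbit and a part with bounded backward orbit. The second tool is a dichotomy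
  (\<open>forward_bounded_contraction\<close>, \<open>backward_bounded_contraction\<close>, \<open>window_bound\<close>): differences of
  two orbits with the same itinerary, and tangent vectors, obey the same approximate recursion
  \<open>hyp_step\<close>, which expands one cone forwards and the complementary cone backwards. It gives
  uniqueness of the point with a given itinerary, continuity of the coding, hyperbolicity,
  and the exponential convergence inside local stable sets.

  The blender property (\<open>vertical_curve_step\<close>) comes from the overlap of the two weak expansions:
  \<open>(I - 10) / (3/2)\<close> and \<open>(I + 10) / (3/2)\<close> cover \<open>I = [-16, 16]\<close>;
  intervals with this property exist because \<open>3/2 < 2\<close>. A curve that
  crosses both strips almost vertically at a position \<open>x \<in> I\<close> is mapped to two such
  curves, one for each strip, and by choosing the strip according to the position of \<open>x\<close> one of them stays
  in \<open>I\<close>. Repeating this gives nested arcs of the original curve; a common point of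
  them never leaves the strips, so it lies on the stable set of the point of the horseshoe with the same
  forward itinerary. The past of that point is still free, and choosing the last symbol to
  match the level \<open>z = 10\<close> of the disks makes this a local stable set.
\<close>

section \<open>Weighted norms and uniform dichotomy of difference sequences\<close>

text \<open>The weights \<open>10, 1, 14\<close> make the model map \<open>(3/2 x + y, m y, y)\<close> uniformly hyperbolic in one
  step: \<open>\<bar>x\<bar> / 10\<close> grows by at least \<open>3/2 - 1/10\<close> when it dominates \<open>\<bar>y\<bar>\<close>, and \<open>\<bar>z\<bar> / 14\<close> becomes at most
  \<open>\<bar>y\<bar> / 14\<close>. They also make the boxes of radius 3 around the centers of the two strips so wide in \<open>x\<close> and
  \<open>z\<close> that every itinerary is realized inside them.\<close>

definition unorm :: "real^3 \<Rightarrow> real" where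
  "unorm d = max (\<bar>d$1\<bar> / 10) \<bar>d$2\<bar>"

definition snorm :: "real^3 \<Rightarrow> real" where
  "snorm d = \<bar>d$3\<bar> / 14"

definition wnorm :: "real^3 \<Rightarrow> real" where
  "wnorm d = max (unorm d) (snorm d)"

lemma unorm_nonneg [simp]: "0 \<le> unorm d"
  by (simp add: unorm_def max_def)

lemma snorm_nonneg [simp]: "0 \<le> snorm d"
  by (simp add: snorm_def)

lemma wnorm_nonneg [simp]: "0 \<le> wnorm d"
  by (simp add: wnorm_def max_def)

lemma wnorm_le_iff: "wnorm d \<le> r \<longleftrightarrow> \<bar>d$1\<bar> \<le> 10 * r \<and> \<bar>d$2\<bar> \<le> r \<and> \<bar>d$3\<bar> \<le> 14 * r"
  by (auto simp: wnorm_def unorm_def snorm_def field_simps)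

lemma wnorm_comp: "\<bar>d$1\<bar> \<le> 10 * wnorm d" "\<bar>d$2\<bar> \<le> wnorm d" "\<bar>d$3\<bar> \<le> 14 * wnorm d"
  using wnorm_le_iff[of d "wnorm d"] by auto

lemma wnorm_triangle: "wnorm (p + q) \<le> wnorm p + wnorm q"
  unfolding wnorm_le_iff using wnorm_comp[of p] wnorm_comp[of q] by (auto simp: algebra_simps)

lemma wnorm_minus: "wnorm (- p) = wnorm p"
  by (simp add: wnorm_def unorm_def snorm_def)

lemma wnorm_minus_commute: "wnorm (p - q) = wnorm (q - p)"
  using wnorm_minus[of "q - p"] by simp

lemma wnorm_diff_triangle: "wnorm (p - q) \<le> wnorm (p - t) + wnorm (t - q)"
  using wnorm_triangle[of "p - t" "t - q"] by simp

lemma norm_vec3_le: "norm (d::real^3) \<le> \<bar>d$1\<bar> + \<bar>d$2\<bar> + \<bar>d$3\<bar>"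
  using norm_le_l1_cart[of d] by (simp add: sum_3)

lemma norm_le_wnorm: "norm d \<le> 25 * wnorm d"
  using norm_vec3_le[of d] wnorm_comp[of d] by linarith

lemma wnorm_le_norm: "wnorm d \<le> norm d"
  unfolding wnorm_le_iff using component_le_norm_cart[of d 1] component_le_norm_cart[of d 2]
    component_le_norm_cart[of d 3] by auto

lemma wnorm_eq_0: "wnorm d \<le> 0 \<Longrightarrow> d = 0"
  using norm_le_wnorm[of d] wnorm_nonneg[of d] by simp

text \<open>The common recursion of differences of orbits and of tangent vectors. The factor \<open>m\<close> is
  the slope of the quadratic map, which may vary from step to step but stays away from 0 near the
  two strips; the error terms absorb the perturbation.\<close>

definition hyp_step :: "real^3 \<Rightarrow> real^3 \<Rightarrow> bool" where
  "hyp_step d d' \<longleftrightarrow> (\<exists>m. 6 \<le> \<bar>m\<bar> \<and>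
     \<bar>d'$1 - (3/2 * d$1 + d$2)\<bar> \<le> wnorm d / 100 \<and>
     \<bar>d'$2 - m * d$2\<bar> \<le> wnorm d / 100 \<and>
     \<bar>d'$3 - d$2\<bar> \<le> wnorm d / 100)"

lemma hyp_step_unorm:
  assumes "hyp_step d d'"
  shows "unorm d' \<ge> 7/5 * unorm d - wnorm d / 100"
proof -
  obtain m where m: "6 \<le> \<bar>m\<bar>" "\<bar>d'$1 - (3/2 * d$1 + d$2)\<bar> \<le> wnorm d / 100"
     "\<bar>d'$2 - m * d$2\<bar> \<le> wnorm d / 100"
    using assms unfolding hyp_step_def by blast
  show ?thesis
  proof (cases "\<bar>d$1\<bar> / 10 \<le> \<bar>d$2\<bar>")
    case True
    have "6 * \<bar>d$2\<bar> \<le> \<bar>m * d$2\<bar>"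
      using m(1) by (simp add: abs_mult mult_right_mono)
    then have "\<bar>d'$2\<bar> \<ge> 6 * \<bar>d$2\<bar> - wnorm d / 100" using m(3) by linarith
    moreover have "unorm d = \<bar>d$2\<bar>" using True by (simp add: unorm_def)
    moreover have "unorm d' \<ge> \<bar>d'$2\<bar>" by (simp add: unorm_def)
    ultimately show ?thesis by linarith
  next
    case False
    have "unorm d = \<bar>d$1\<bar> / 10" using False by (simp add: unorm_def)
    moreover have "unorm d' \<ge> \<bar>d'$1\<bar> / 10" by (simp add: unorm_def)
    moreover have "\<bar>d'$1\<bar> \<ge> 3/2 * \<bar>d$1\<bar> - \<bar>d$2\<bar> - wnorm d / 100"
      using m(2) by linarith
    ultimately show ?thesis using False wnorm_nonneg[of d] by linarith
  qed
qed

lemma hyp_step_snorm: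
  assumes "hyp_step d d'"
  shows "14 * snorm d' \<le> unorm d + wnorm d / 100"
proof -
  have "\<bar>d'$3 - d$2\<bar> \<le> wnorm d / 100"
    using assms unfolding hyp_step_def by blast
  moreover have "\<bar>d$2\<bar> \<le> unorm d" by (simp add: unorm_def)
  ultimately show ?thesis unfolding snorm_def by linarith
qed

lemma unstable_cone_step:
  assumes "hyp_step d d'" "snorm d \<le> unorm d"
  shows "snorm d' \<le> unorm d'" "unorm d \<le> 3/4 * unorm d'"
proof -
  have w: "wnorm d = unorm d" using assms(2) by (simp add: wnorm_def)
  have 1: "unorm d' \<ge> 7/5 * unorm d - unorm d / 100"
    using hyp_step_unorm[OF assms(1)] by (simp add: w)
  have 2: "14 * snorm d' \<le> unorm d + unorm d / 100"
    using hyp_step_snorm[OF assms(1)] by (simp add: w)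
  show "snorm d' \<le> unorm d'"
    using 1 2 unorm_nonneg[of d] by linarith
  show "unorm d \<le> 3/4 * unorm d'"
    using 1 unorm_nonneg[of d] by linarith
qed

text \<open>The estimates of the unstable cone read backwards: an
  image with dominating stable part can only come from a vector that is almost entirely stable,
  because the unstable part would have grown.\<close>

lemma stable_cone_step:
  assumes "hyp_step d d'" "unorm d' \<le> snorm d'"
  shows "unorm d \<le> snorm d / 50" "snorm d' \<le> 3/4 * snorm d"
proof -
  have w: "wnorm d \<le> unorm d + snorm d" by (simp add: wnorm_def)
  have 1: "unorm d' \<ge> 7/5 * unorm d - wnorm d / 100"
    using hyp_step_unorm[OF assms(1)] .
  have 2: "14 * snorm d' \<le> unorm d + wnorm d / 100"
    using hyp_step_snorm[OF assms(1)] .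
  show 3: "unorm d \<le> snorm d / 50"
    using 1 2 w assms(2) unorm_nonneg[of d] snorm_nonneg[of d] by linarith
  show "snorm d' \<le> 3/4 * snorm d"
    using 2 3 w unorm_nonneg[of d] snorm_nonneg[of d] by linarith
qed

lemma unstable_cone_growth:
  assumes "\<And>i. i < k \<Longrightarrow> hyp_step (d i) (d (Suc i))" "snorm (d 0) \<le> unorm (d 0)"
  shows "snorm (d k) \<le> unorm (d k) \<and> unorm (d 0) \<le> (3/4) ^ k * unorm (d k)"
  using assms(1)
proof (induction k)
  case 0
  then show ?case using assms(2) by simp
next
  case (Suc k)
  then have IH: "snorm (d k) \<le> unorm (d k)" "unorm (d 0) \<le> (3/4) ^ k * unorm (d k)" by auto
  have st: "hyp_step (d k) (d (Suc k))" using Suc.prems by simp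
  have "(3/4) ^ k * unorm (d k) \<le> (3/4) ^ k * (3/4 * unorm (d (Suc k)))"
    using unstable_cone_step(2)[OF st IH(1)] by (intro mult_left_mono) auto
  moreover have "(3/4) ^ k * (3/4 * unorm (d (Suc k))) = (3/4) ^ Suc k * unorm (d (Suc k))" by simp
  ultimately have "unorm (d 0) \<le> (3/4) ^ Suc k * unorm (d (Suc k))" using IH(2) by linarith
  then show ?case using unstable_cone_step(1)[OF st IH(1)] by blast
qed

lemma stable_cone_growth:
  assumes "\<And>i. i < k \<Longrightarrow> hyp_step (d (Suc i)) (d i)" "unorm (d 0) \<le> snorm (d 0)"
  shows "unorm (d k) \<le> snorm (d k) \<and> snorm (d 0) \<le> (3/4) ^ k * snorm (d k)"
  using assms(1)
proof (induction k)
  case 0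
  then show ?case using assms(2) by simp
next
  case (Suc k)
  then have IH: "unorm (d k) \<le> snorm (d k)" "snorm (d 0) \<le> (3/4) ^ k * snorm (d k)" by auto
  have st: "hyp_step (d (Suc k)) (d k)" using Suc.prems by simp
  have "(3/4) ^ k * snorm (d k) \<le> (3/4) ^ k * (3/4 * snorm (d (Suc k)))"
    using stable_cone_step(2)[OF st IH(1)] by (intro mult_left_mono) auto
  moreover have "(3/4) ^ k * (3/4 * snorm (d (Suc k))) = (3/4) ^ Suc k * snorm (d (Suc k))" by simp
  ultimately have "snorm (d 0) \<le> (3/4) ^ Suc k * snorm (d (Suc k))" using IH(2) by linarith
  moreover have "unorm (d (Suc k)) \<le> snorm (d (Suc k))"
    using stable_cone_step(1)[OF st IH(1)] snorm_nonneg[of "d (Suc k)"] by linarith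
  ultimately show ?case by blast
qed

lemma geometric_bound_nonpos:
  fixes a B :: real
  assumes "\<And>k::nat. a \<le> (3/4) ^ k * B"
  shows "a \<le> 0"
proof -
  have "(\<lambda>k. (3/4::real) ^ k * B) \<longlonglongrightarrow> 0"
    by (intro tendsto_mult_left_zero LIMSEQ_power_zero) auto
  then show ?thesis by (rule LIMSEQ_le_const) (use assms in auto)
qed

text \<open>A vector outside the stable cone enters the unstable cone and then grows without bound.
  The factor 1/50 makes stable sets nearly parallel to the \<open>z\<close> axis.\<close>

lemma forward_bounded_stable_cone:
  assumes st: "\<And>n. hyp_step (d n) (d (Suc n))" and bd: "\<And>n. wnorm (d n) \<le> B"
  shows "unorm (d n) \<le> snorm (d n) / 50"
proof -
  have le: "unorm (d n) \<le> snorm (d n)" for n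
  proof (rule ccontr)
    assume neg: "\<not> unorm (d n) \<le> snorm (d n)"
    have "unorm (d n) \<le> (3/4) ^ k * B" for k
    proof -
      have "unorm (d (n + 0)) \<le> (3/4) ^ k * unorm (d (n + k))"
        using unstable_cone_growth[of k "\<lambda>i. d (n + i)"] st neg by auto
      also have "\<dots> \<le> (3/4) ^ k * B"
        using bd[of "n + k"] by (intro mult_left_mono) (auto simp: wnorm_def)
      finally show ?thesis by simp
    qed
    then have "unorm (d n) \<le> 0" by (rule geometric_bound_nonpos)
    then show False using neg snorm_nonneg[of "d n"] by linarith
  qed
  show ?thesis using stable_cone_step(1)[OF st le] .
qed

lemma forward_bounded_contraction:
  assumes st: "\<And>n. hyp_step (d n) (d (Suc n))" and bd: "\<And>n. wnorm (d n) \<le> B"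
  shows "wnorm (d n) \<le> (3/4) ^ n * wnorm (d 0)"
proof -
  have le: "unorm (d n) \<le> snorm (d n)" for n
    using forward_bounded_stable_cone[of d B n, OF st bd] snorm_nonneg[of "d n"] by linarith
  then have w: "wnorm (d n) = snorm (d n)" for n by (simp add: wnorm_def)
  show ?thesis
  proof (induction n)
    case (Suc n)
    have "wnorm (d (Suc n)) \<le> 3/4 * wnorm (d n)"
      using stable_cone_step(2)[OF st le] by (simp add: w)
    then show ?case using Suc by simp
  qed simp
qed

lemma backward_bounded_unstable_cone:
  assumes st: "\<And>n. hyp_step (d (Suc n)) (d n)" and bd: "\<And>n. wnorm (d n) \<le> B"
  shows "snorm (d n) \<le> unorm (d n)"
proof (rule ccontr)
  assume neg: "\<not> snorm (d n) \<le> unorm (d n)"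
  have "snorm (d n) \<le> (3/4) ^ k * B" for k
  proof -
    have "snorm (d (n + 0)) \<le> (3/4) ^ k * snorm (d (n + k))"
      using stable_cone_growth[of k "\<lambda>i. d (n + i)"] st neg by auto
    also have "\<dots> \<le> (3/4) ^ k * B"
      using bd[of "n + k"] by (intro mult_left_mono) (auto simp: wnorm_def)
    finally show ?thesis by simp
  qed
  then have "snorm (d n) \<le> 0" by (rule geometric_bound_nonpos)
  then show False using neg unorm_nonneg[of "d n"] by linarith
qed

lemma backward_bounded_contraction:
  assumes st: "\<And>n. hyp_step (d (Suc n)) (d n)" and bd: "\<And>n. wnorm (d n) \<le> B"
  shows "wnorm (d n) \<le> (3/4) ^ n * wnorm (d 0)"
proof -
  have le: "snorm (d n) \<le> unorm (d n)" for n
    by (rule backward_bounded_unstable_cone[of d B]) (use st bd in auto)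
  then have w: "wnorm (d n) = unorm (d n)" for n by (simp add: wnorm_def)
  show ?thesis
  proof (induction n)
    case (Suc n)
    have "wnorm (d (Suc n)) \<le> 3/4 * wnorm (d n)"
      using unstable_cone_step(2)[OF st le] by (simp add: w)
    then show ?case using Suc by simp
  qed simp
qed

text \<open>A finite form of expansiveness: according to the cone that contains the vector at time 0,
  the bound at the right end or at the left end of the window is the effective one. It gives
  uniqueness when applied to all windows and continuity of the coding when applied to one.\<close>

lemma window_bound:
  fixes d :: "int \<Rightarrow> real^3"
  assumes st: "\<And>n. - int k \<le> n \<Longrightarrow> n < int k \<Longrightarrow> hyp_step (d n) (d (n + 1))"
    and bd: "\<And>n. wnorm (d n) \<le> B"
  shows "wnorm (d 0) \<le> (3/4) ^ k * B"
proof (cases "snorm (d 0) \<le> unorm (d 0)")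
  case True
  have "hyp_step (d (int i)) (d (int (Suc i)))" if "i < k" for i
    using st[of "int i"] that by (simp add: add.commute)
  then have "unorm (d 0) \<le> (3/4) ^ k * unorm (d (int k))"
    using unstable_cone_growth[of k "\<lambda>i. d (int i)"] True by auto
  also have "\<dots> \<le> (3/4) ^ k * B"
    using bd[of "int k"] by (intro mult_left_mono) (auto simp: wnorm_def)
  finally show ?thesis using True by (simp add: wnorm_def)
next
  case False
  have "hyp_step (d (- int (Suc i))) (d (- int i))" if "i < k" for i
    using st[of "- int (Suc i)"] that by simp
  then have "snorm (d 0) \<le> (3/4) ^ k * snorm (d (- int k))"
    using stable_cone_growth[of k "\<lambda>i. d (- int i)"] False by auto
  also have "\<dots> \<le> (3/4) ^ k * B"
    using bd[of "- int k"] by (intro mult_left_mono) (auto simp: wnorm_def)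
  finally show ?thesis using False by (simp add: wnorm_def)
qed

section \<open>Orbits of almost hyperbolic sequences of maps\<close>

lemma wnorm_tendsto:
  assumes "p \<longlonglongrightarrow> l"
  shows "(\<lambda>k. wnorm (p k - q)) \<longlonglongrightarrow> wnorm (l - q)"
  unfolding wnorm_def unorm_def snorm_def
  by (intro tendsto_intros assms) auto

text \<open>Banach's fixed point theorem for families of vectors with the supremum distance, on the
  ball of radius \<open>\<rho>\<close> around the family \<open>c\<close>. The center \<open>c\<close> itself may be unbounded, so the iteration
  is carried out index by index, with bounds uniform in the index.\<close>

lemma sequence_contraction_fixpoint:
  fixes T :: "('i \<Rightarrow> real^3) \<Rightarrow> 'i \<Rightarrow> real^3"
  assumes th: "0 \<le> \<theta>" "\<theta> < 1" and \<rho>: "0 \<le> \<rho>"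
    and lip: "\<And>w w' D. \<lbrakk>\<And>n. wnorm (w n - c n) \<le> \<rho>; \<And>n. wnorm (w' n - c n) \<le> \<rho>;
        \<And>n. wnorm (w n - w' n) \<le> D\<rbrakk> \<Longrightarrow> \<forall>n. wnorm (T w n - T w' n) \<le> \<theta> * D"
    and start: "\<And>n. wnorm (T c n - c n) \<le> (1 - \<theta>) * \<rho>"
  obtains w where "T w = w" "\<And>n. wnorm (w n - c n) \<le> \<rho>"
proof -
  define W where "W k = (T ^^ k) c" for k
  have W0: "W 0 = c" and WS: "W (Suc k) = T (W k)" for k by (simp_all add: W_def)
  have main: "(\<forall>n. wnorm (W k n - c n) \<le> (1 - \<theta> ^ k) * \<rho>) \<and>
      (\<forall>n. wnorm (W (Suc k) n - W k n) \<le> \<theta> ^ k * ((1 - \<theta>) * \<rho>))" for k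
  proof (induction k)
    case 0
    then show ?case using start by (simp add: W0 WS) (simp add: wnorm_def unorm_def snorm_def)
  next
    case (Suc k)
    have a: "wnorm (W (Suc k) n - c n) \<le> (1 - \<theta> ^ Suc k) * \<rho>" for n
    proof -
      have "wnorm (W (Suc k) n - c n) \<le> \<theta> ^ k * ((1 - \<theta>) * \<rho>) + (1 - \<theta> ^ k) * \<rho>"
        using wnorm_diff_triangle[of "W (Suc k) n" "c n" "W k n"] Suc by (meson add_mono order_trans)
      then show ?thesis by (simp add: algebra_simps)
    qed
    have in1: "(1 - \<theta> ^ j) * \<rho> \<le> \<rho>" for j
      using th \<rho> by (intro mult_left_le_one_le) (auto simp: power_le_one)
    have "\<forall>n. wnorm (T (W (Suc k)) n - T (W k) n) \<le> \<theta> * (\<theta> ^ k * ((1 - \<theta>) * \<rho>))"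
      using a in1 Suc by (intro lip) (meson order_trans)+
    then show ?case using a by (simp add: WS mult_ac)
  qed
  have diff: "wnorm (W (k + j) n - W k n) \<le> \<theta> ^ k * (1 - \<theta> ^ j) * \<rho>" for k j n
  proof (induction j)
    case 0
    then show ?case by (simp add: wnorm_def unorm_def snorm_def)
  next
    case (Suc j)
    have "wnorm (W (Suc (k + j)) n - W (k + j) n) \<le> \<theta> ^ (k + j) * ((1 - \<theta>) * \<rho>)"
      using main[of "k + j"] by blast
    then have "wnorm (W (k + Suc j) n - W k n)
        \<le> \<theta> ^ (k + j) * ((1 - \<theta>) * \<rho>) + \<theta> ^ k * (1 - \<theta> ^ j) * \<rho>"
      using wnorm_diff_triangle[of "W (k + Suc j) n" "W k n" "W (k + j) n"] Suc by simp
    then show ?case by (simp add: algebra_simps power_add)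
  qed
  have diff': "wnorm (W m n - W k n) \<le> \<theta> ^ k * \<rho>" if "k \<le> m" for k m n
  proof -
    have "\<theta> ^ k * (1 - \<theta> ^ (m - k)) * \<rho> \<le> \<theta> ^ k * 1 * \<rho>"
      using th \<rho> by (intro mult_right_mono mult_left_mono) auto
    then show ?thesis using diff[of k "m - k" n] that by simp
  qed
  have lim0: "(\<lambda>k. C * (\<theta> ^ k * \<rho>)) \<longlonglongrightarrow> 0" for C
    using th by (intro tendsto_mult_right_zero tendsto_mult_left_zero LIMSEQ_power_zero) auto
  have "Cauchy (\<lambda>k. W k n)" for n
  proof (rule metric_CauchyI)
    fix e :: real assume "0 < e"
    then obtain M where M: "\<And>k. M \<le> k \<Longrightarrow> 50 * (\<theta> ^ k * \<rho>) < e"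
      using order_tendstoD(2)[OF lim0[of 50]] unfolding eventually_sequentially by blast
    have "dist (W m n) (W M n) < e / 2" if "M \<le> m" for m
      using norm_le_wnorm[of "W m n - W M n"] diff'[OF that, of n] M[of M] by (simp add: dist_norm)
    then have "dist (W m n) (W k n) < e" if "M \<le> m" "M \<le> k" for m k
      using that dist_triangle_half_l by blast
    then show "\<exists>M. \<forall>m\<ge>M. \<forall>k\<ge>M. dist (W m n) (W k n) < e" by blast
  qed
  then have "\<forall>n. \<exists>l. (\<lambda>k. W k n) \<longlonglongrightarrow> l"
    using Cauchy_convergent convergent_def by blast
  then obtain w where w: "\<And>n. (\<lambda>k. W k n) \<longlonglongrightarrow> w n" by metis
  have wk: "wnorm (w n - W k n) \<le> \<theta> ^ k * \<rho>" for n k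
    by (rule LIMSEQ_le_const2[OF wnorm_tendsto[OF w]]) (use diff' in auto)
  have wc: "wnorm (w n - c n) \<le> \<rho>" for n using wk[of n 0] by (simp add: W0)
  have Wc: "wnorm (W k n - c n) \<le> \<rho>" for n k using diff'[of 0 k n] by (simp add: W0)
  have "T w n = w n" for n
  proof (rule LIMSEQ_unique)
    show "(\<lambda>k. W (Suc k) n) \<longlonglongrightarrow> w n" using w[of n] by (rule LIMSEQ_Suc)
    have b: "norm (W (Suc k) n - T w n) \<le> 25 * \<theta> * (\<theta> ^ k * \<rho>)" for k
    proof -
      have "wnorm (T w n - T (W k) n) \<le> \<theta> * (\<theta> ^ k * \<rho>)"
        using lip[of w "W k" "\<theta> ^ k * \<rho>"] wc Wc wk by blast
      then show ?thesis using norm_le_wnorm[of "T w n - T (W k) n"] by (simp add: WS norm_minus_commute)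
    qed
    have "(\<lambda>k. W (Suc k) n - T w n) \<longlonglongrightarrow> 0"
      by (rule Lim_null_comparison[OF _ lim0[of "25 * \<theta>"]]) (use b in auto)
    then show "(\<lambda>k. W (Suc k) n) \<longlonglongrightarrow> T w n" by (simp add: LIM_zero_iff)
  qed
  then show thesis using that wc by blast
qed

text \<open>The equations \<open>f n (w n) = w (n + 1)\<close> are rewritten as a fixed point problem in the direction
  in which each coordinate contracts: \<open>x\<close> and \<open>y\<close> at time \<open>n\<close> are computed from time \<open>n + 1\<close> by dividing by
  \<open>3/2\<close> and by \<open>m n\<close> (a Newton step with frozen slope), and \<open>z\<close> at time \<open>n\<close> is read off from time
  \<open>n - 1\<close>. The hypothesis \<open>start\<close> says that \<open>c\<close> is almost an orbit, up to a quarter of the radius.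
  The maps may depend on the time, which allows affine maps of tangent spaces as well as a fixed
  nonlinear map.\<close>

lemma shadowing_orbit:
  fixes f :: "int \<Rightarrow> real^3 \<Rightarrow> real^3" and c :: "int \<Rightarrow> real^3" and m :: "int \<Rightarrow> real"
  assumes \<rho>: "0 \<le> \<rho>" and m: "\<And>n. 10 \<le> \<bar>m n\<bar>"
    and lip: "\<And>n p q. \<lbrakk>wnorm (p - c n) \<le> \<rho>; wnorm (q - c n) \<le> \<rho>\<rbrakk> \<Longrightarrow>
        \<bar>(f n p - f n q)$1 - (3/2 * (p - q)$1 + (p - q)$2)\<bar> \<le> wnorm (p - q) / 100 \<and>
        \<bar>(f n p - f n q)$2 - m n * (p - q)$2\<bar> \<le> 2/5 * \<bar>m n\<bar> * wnorm (p - q) \<and>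
        \<bar>(f n p - f n q)$3 - (p - q)$2\<bar> \<le> wnorm (p - q) / 100"
    and start: "\<And>n. \<bar>(f n (c n) - c (n + 1))$1\<bar> \<le> 15/4 * \<rho> \<and>
        \<bar>(f n (c n) - c (n + 1))$2\<bar> \<le> \<bar>m n\<bar> * \<rho> / 4 \<and>
        \<bar>(f n (c n) - c (n + 1))$3\<bar> \<le> 7/2 * \<rho>"
  obtains w where "\<And>n. f n (w n) = w (n + 1)" "\<And>n. wnorm (w n - c n) \<le> \<rho>"
proof -
  define T where "T w n = (vector
      [(w (n + 1) $ 1 - (f n (w n) $ 1 - 3/2 * w n $ 1)) / (3/2),
       w n $ 2 - (f n (w n) $ 2 - w (n + 1) $ 2) / m n,
       f (n - 1) (w (n - 1)) $ 3] :: real^3)" for w :: "int \<Rightarrow> real^3" and n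
  have m0: "m n \<noteq> 0" for n using m[of n] by auto
  have "\<exists>w. T w = w \<and> (\<forall>n. wnorm (w n - c n) \<le> \<rho>)"
  proof (rule sequence_contraction_fixpoint[of "3/4" \<rho> c T])
    fix w w' :: "int \<Rightarrow> real^3" and D
    assume w: "\<And>n. wnorm (w n - c n) \<le> \<rho>" "\<And>n. wnorm (w' n - c n) \<le> \<rho>"
      and D: "\<And>n. wnorm (w n - w' n) \<le> D"
    show "\<forall>n. wnorm (T w n - T w' n) \<le> 3/4 * D"
    proof
      fix n
      define d where "d = w n - w' n"
      define d' where "d' = w (n + 1) - w' (n + 1)"
      define D0 where "D0 = f n (w n) - f n (w' n)"
      have L: "\<bar>D0$1 - (3/2 * d$1 + d$2)\<bar> \<le> wnorm d / 100"
           "\<bar>D0$2 - m n * d$2\<bar> \<le> 2/5 * \<bar>m n\<bar> * wnorm d"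
        using lip[OF w(1) w(2), of n] unfolding d_def D0_def by blast+
      have L3: "\<bar>(f (n-1) (w (n-1)) - f (n-1) (w' (n-1)))$3 - (w (n-1) - w' (n-1))$2\<bar>
          \<le> wnorm (w (n-1) - w' (n-1)) / 100"
        using lip[OF w(1) w(2), of "n - 1"] by blast
      have d: "wnorm d \<le> D" "wnorm d' \<le> D" using D by (auto simp: d_def d'_def)
      have c1: "(T w n - T w' n)$1 = (d'$1 - d$2 - (D0$1 - (3/2 * d$1 + d$2))) / (3/2)"
        by (simp add: T_def d_def d'_def D0_def field_simps)
      have c2: "(T w n - T w' n)$2 = - (D0$2 - m n * d$2) / m n + d'$2 / m n"
        using m0[of n] by (simp add: T_def d_def d'_def D0_def field_simps)
      have c3: "(T w n - T w' n)$3 = (f (n-1) (w (n-1)) - f (n-1) (w' (n-1)))$3"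
        by (simp add: T_def)
      have 1: "\<bar>(T w n - T w' n)$1\<bar> \<le> 10 * (3/4 * D)"
      proof -
        have "\<bar>d'$1 - d$2 - (D0$1 - (3/2 * d$1 + d$2))\<bar> \<le> 45/4 * D"
          using L(1) wnorm_comp[of d] wnorm_comp[of d'] d wnorm_nonneg[of d] by linarith
        then show ?thesis unfolding c1 abs_divide by simp
      qed
      have "\<bar>- (D0$2 - m n * d$2) / m n\<bar> \<le> 2/5 * wnorm d"
      proof -
        have "\<bar>D0$2 - m n * d$2\<bar> / \<bar>m n\<bar> \<le> 2/5 * wnorm d"
          using L(2) m[of n] by (subst pos_divide_le_eq) (auto simp: mult_ac)
        then show ?thesis by (simp only: abs_divide abs_minus_cancel)
      qed
      moreover have "\<bar>d'$2 / m n\<bar> \<le> D / 10"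
      proof -
        have "\<bar>d'$2\<bar> / \<bar>m n\<bar> \<le> D / 10"
          using wnorm_comp(2)[of d'] d(2) m[of n] by (intro frac_le) auto
        then show ?thesis by (simp add: abs_divide)
      qed
      ultimately have 2: "\<bar>(T w n - T w' n)$2\<bar> \<le> 3/4 * D"
        unfolding c2 using d wnorm_nonneg[of d] by linarith
      have 3: "\<bar>(T w n - T w' n)$3\<bar> \<le> 14 * (3/4 * D)"
        unfolding c3 using L3 wnorm_comp(2)[of "w (n-1) - w' (n-1)"] D[of "n-1"]
          wnorm_nonneg[of "w (n-1) - w' (n-1)"] by linarith
      show "wnorm (T w n - T w' n) \<le> 3/4 * D"
        unfolding wnorm_le_iff using 1 2 3 by blast
    qed
  next
    fix n
    have 1: "\<bar>(T c n - c n)$1\<bar> \<le> 10 * (1/4 * \<rho>)"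
    proof -
      have e: "(T c n - c n)$1 = - (f n (c n) - c (n + 1))$1 / (3/2)" by (simp add: T_def field_simps)
      have "\<bar>(f n (c n) - c (n + 1))$1\<bar> / (3/2) \<le> 10 * (1/4 * \<rho>)" using start[of n] by simp
      then show ?thesis unfolding e by (simp only: abs_divide abs_minus_cancel)
    qed
    have "(T c n - c n)$2 = - (f n (c n) - c (n + 1))$2 / m n"
      using m0[of n] by (simp add: T_def divide_simps)
    moreover have "\<bar>- (f n (c n) - c (n + 1))$2 / m n\<bar> \<le> 1/4 * \<rho>"
    proof -
      have "\<bar>(f n (c n) - c (n + 1))$2\<bar> / \<bar>m n\<bar> \<le> 1/4 * \<rho>"
        using start[of n] m[of n] by (subst pos_divide_le_eq) (auto simp: mult_ac)
      then show ?thesis by (simp only: abs_divide abs_minus_cancel)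
    qed
    ultimately have 2: "\<bar>(T c n - c n)$2\<bar> \<le> 1/4 * \<rho>" by simp
    have 3: "\<bar>(T c n - c n)$3\<bar> \<le> 14 * (1/4 * \<rho>)"
      using start[of "n - 1"] by (simp add: T_def)
    show "wnorm (T c n - c n) \<le> (1 - 3/4) * \<rho>" unfolding wnorm_le_iff using 1 2 3 by simp
  qed (use \<rho> in auto)
  then obtain w where w: "T w = w" "\<And>n. wnorm (w n - c n) \<le> \<rho>" by blast
  have "f n (w n) = w (n + 1)" for n
  proof -
    have t: "T w n $ i = w n $ i" "T w (n+1) $ i = w (n+1) $ i" for i using w(1) by auto
    have "f n (w n) $ 1 = w (n + 1) $ 1" using t(1)[of 1] by (simp add: T_def)
    moreover have "f n (w n) $ 2 = w (n + 1) $ 2" using t(1)[of 2] m0[of n] by (simp add: T_def)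
    moreover have "f n (w n) $ 3 = w (n + 1) $ 3" using t(2)[of 3] by (simp add: T_def)
    ultimately show ?thesis by (simp add: vec_eq_iff forall_3)
  qed
  then show thesis using that w(2) by blast
qed

section \<open>Maps near the base map\<close>

definition henon0 :: "real^3 \<Rightarrow> real^3" where
  "henon0 = cu_henon (3/2) (-100) 0 0"

text \<open>The ball of radius 200 contains the boxes of weighted radius 7 around both strips, where all
  estimates take place; \<open>1/10000\<close> is small enough for the error terms of \<open>hyp_step\<close>.\<close>

definition henon_nbhd :: "(real^3 \<Rightarrow> real^3) set" where
  "henon_nbhd = {g. Cr_diffeo 1 g \<and> Cr_close 1 (cball 0 200) (1/10000) g henon0}"

lemma cu_henon_nth:
  "cu_henon \<xi> \<mu> \<kappa> \<eta> p $ 1 = \<xi> * p$1 + p$2"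
  "cu_henon \<xi> \<mu> \<kappa> \<eta> p $ 2 = \<mu> + (p$2)\<^sup>2 + \<kappa> * (p$1)\<^sup>2 + \<eta> * p$1 * p$2"
  "cu_henon \<xi> \<mu> \<kappa> \<eta> p $ 3 = p$2"
  by (simp_all add: cu_henon_def Let_def)

lemma cu_henon_has_derivative:
  fixes p :: "real^3"
  shows
  "(cu_henon \<xi> \<mu> \<kappa> \<eta> has_derivative (\<lambda>v. vector [\<xi> * v$1 + v$2,
      (2 * \<kappa> * p$1 + \<eta> * p$2) * v$1 + (2 * p$2 + \<eta> * p$1) * v$2, v$2])) (at p)"
proof -
  have nth: "((\<lambda>x. x $ i) has_derivative (\<lambda>v. v $ i)) (at p)" for i :: 3
    by (rule bounded_linear_imp_has_derivative[OF bounded_linear_vec_nth])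
  have "((\<lambda>x. cu_henon \<xi> \<mu> \<kappa> \<eta> x $ i) has_derivative (\<lambda>v. (vector [\<xi> * v$1 + v$2,
      (2 * \<kappa> * p$1 + \<eta> * p$2) * v$1 + (2 * p$2 + \<eta> * p$1) * v$2, v$2] :: real^3) $ i)) (at p)" for i :: 3
  proof -
    consider "i = 1" | "i = 2" | "i = 3" using exhaust_3 by blast
    then show ?thesis
    proof cases
      case 1
      show ?thesis unfolding 1 cu_henon_nth vector_3
        by (rule has_derivative_add[OF has_derivative_mult_right[OF nth] nth])
    next
      case 2
      note xx = has_derivative_mult[OF nth nth]
      have D: "((\<lambda>x. \<mu> + x$2 * x$2 + \<kappa> * (x$1 * x$1) + \<eta> * (x$1 * x$2)) has_derivative
        (\<lambda>v. 0 + (p$2 * v$2 + v$2 * p$2) + \<kappa> * (p$1 * v$1 + v$1 * p$1)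
           + \<eta> * (p$1 * v$2 + v$1 * p$2))) (at p)"
        by (rule has_derivative_add[OF has_derivative_add[OF has_derivative_add[OF
              has_derivative_const xx] has_derivative_mult_right[OF xx]] has_derivative_mult_right[OF xx]])
      have e1: "(\<lambda>v::real^3. 0 + (p$2 * v$2 + v$2 * p$2) + \<kappa> * (p$1 * v$1 + v$1 * p$1)
           + \<eta> * (p$1 * v$2 + v$1 * p$2))
         = (\<lambda>v. (2 * \<kappa> * p$1 + \<eta> * p$2) * v$1 + (2 * p$2 + \<eta> * p$1) * v$2)"
        by (simp add: algebra_simps power2_eq_square)
      have e2: "(\<lambda>x::real^3. \<mu> + x$2 * x$2 + \<kappa> * (x$1 * x$1) + \<eta> * (x$1 * x$2))
         = (\<lambda>x. \<mu> + (x$2)\<^sup>2 + \<kappa> * (x$1)\<^sup>2 + \<eta> * x$1 * x$2)"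
        by (simp add: algebra_simps power2_eq_square)
      show ?thesis unfolding 2 cu_henon_nth vector_3 using D unfolding e1 e2 .
    next
      case 3
      show ?thesis unfolding 3 cu_henon_nth vector_3 by (rule nth)
    qed
  qed
  then show ?thesis
    by (subst has_derivative_componentwise_within) (auto simp: Basis_vec_def inner_axis)
qed

lemma Cr_diffeo_1D:
  assumes "Cr_diffeo 1 g"
  shows "bij g" "\<And>x. g differentiable (at x)" "\<And>x. inv g differentiable (at x)"
proof -
  show "bij g" using assms by (simp add: Cr_diffeo_def)
  show "g differentiable (at x)" "inv g differentiable (at x)" for x
    using assms unfolding Cr_diffeo_def Cr_map_def
    by (metis (no_types, lifting) iter_deriv.simps(1) list.size(3) lists.Nil zero_less_one)+
qed

lemma Cr_close_1D:
  assumes "Cr_close 1 K e f g" "x \<in> K"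
  shows "norm (f x - g x) < e"
    "\<And>b. b \<in> Basis \<Longrightarrow> norm (frechet_derivative f (at x) b - frechet_derivative g (at x) b) < e"
proof -
  show "norm (f x - g x) < e"
    using assms unfolding Cr_close_def by (metis iter_deriv.simps(1) le0 list.size(3) lists.Nil)
  fix b :: 'a assume "b \<in> Basis"
  then have "[b] \<in> lists Basis" "length [b] \<le> 1" by auto
  then have "norm (iter_deriv [b] f x - iter_deriv [b] g x) < e"
    using assms unfolding Cr_close_def by blast
  then show "norm (frechet_derivative f (at x) b - frechet_derivative g (at x) b) < e" by simp
qed

lemma Cr_close_1I:
  assumes "\<And>x. x \<in> K \<Longrightarrow> norm (f x - g x) < e"
    "\<And>x b. x \<in> K \<Longrightarrow> b \<in> Basis \<Longrightarrow> norm (frechet_derivative f (at x) b - frechet_derivative g (at x) b) < e"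
  shows "Cr_close 1 K e f g"
  unfolding Cr_close_def
proof (intro ballI impI)
  fix x and vs :: "'a list" assume "x \<in> K" "vs \<in> lists Basis" "length vs \<le> 1"
  then show "norm (iter_deriv vs f x - iter_deriv vs g x) < e"
    using assms by (cases vs) auto
qed

lemma norm_linear_le_Basis:
  fixes L :: "real^3 \<Rightarrow> 'b::real_normed_vector"
  assumes "linear L" "\<And>b. b \<in> Basis \<Longrightarrow> norm (L b) \<le> e"
  shows "norm (L v) \<le> 3 * e * norm v"
proof -
  have "L v = L (\<Sum>b\<in>Basis. (v \<bullet> b) *\<^sub>R b)" by (simp add: euclidean_representation)
  also have "\<dots> = (\<Sum>b\<in>Basis. (v \<bullet> b) *\<^sub>R L b)"
    using assms(1) by (simp add: linear_sum linear_cmul)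
  also have "norm \<dots> \<le> (\<Sum>b\<in>(Basis::(real^3) set). norm v * e)"
  proof (rule sum_norm_le)
    fix b :: "real^3" assume b: "b \<in> Basis"
    then show "norm ((v \<bullet> b) *\<^sub>R L b) \<le> norm v * e"
      using assms(2)[OF b] Basis_le_norm[OF b, of v] by (simp add: mult_mono)
  qed
  finally show ?thesis by (simp add: mult_ac)
qed

lemma henon_nbhdD:
  assumes "g \<in> henon_nbhd"
  shows "bij g" "\<And>x. g differentiable (at x)" "\<And>x. inv g differentiable (at x)"
    "\<And>x. x \<in> cball 0 200 \<Longrightarrow> norm (g x - henon0 x) < 1/10000"
    "\<And>x b. x \<in> cball 0 200 \<Longrightarrow> b \<in> Basis \<Longrightarrow>
       norm (frechet_derivative g (at x) b - frechet_derivative henon0 (at x) b) < 1/10000"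
proof -
  have d: "Cr_diffeo 1 g" "Cr_close 1 (cball 0 200) (1/10000) g henon0"
    using assms by (simp_all add: henon_nbhd_def)
  show "bij g" "\<And>x. g differentiable (at x)" "\<And>x. inv g differentiable (at x)"
    using Cr_diffeo_1D[OF d(1)] by simp_all
  show "\<And>x. x \<in> cball 0 200 \<Longrightarrow> norm (g x - henon0 x) < 1/10000"
    using Cr_close_1D(1)[OF d(2)] .
  show "\<And>x b. x \<in> cball 0 200 \<Longrightarrow> b \<in> Basis \<Longrightarrow>
       norm (frechet_derivative g (at x) b - frechet_derivative henon0 (at x) b) < 1/10000"
    using Cr_close_1D(2)[OF d(2)] .
qed

lemma frechet_derivative_worksI:
  "f differentiable (at x) \<Longrightarrow> (f has_derivative frechet_derivative f (at x)) (at x)"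
  by (simp add: frechet_derivative_works)

lemma henon0_derivative:
  "frechet_derivative henon0 (at p) v = vector [3/2 * v$1 + v$2, 2 * p$2 * v$2, v$2]"
proof -
  have "(henon0 has_derivative (\<lambda>v. vector [3/2 * v$1 + v$2, 2 * p$2 * v$2, v$2])) (at p)"
    using cu_henon_has_derivative[of "3/2" "-100" 0 0 p] by (simp add: henon0_def)
  from frechet_derivative_at[OF this, symmetric] show ?thesis by simp
qed

lemma henon0_differentiable: "henon0 differentiable (at p)"
  unfolding henon0_def by (rule differentiableI[OF cu_henon_has_derivative])

lemma henon_nbhd_derivative_close:
  assumes g: "g \<in> henon_nbhd" and x: "x \<in> cball 0 200"
  shows "norm (frechet_derivative g (at x) v - frechet_derivative henon0 (at x) v) \<le> 3 / 10000 * norm v"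
proof -
  have "linear (\<lambda>v. frechet_derivative g (at x) v - frechet_derivative henon0 (at x) v)"
    using henon_nbhdD(2)[OF g] henon0_differentiable
    by (intro linear_compose_sub linear_frechet_derivative)
  from norm_linear_le_Basis[OF this, of "1/10000" v] less_imp_le[OF henon_nbhdD(5)[OF g x]]
  show ?thesis by simp
qed

text \<open>The mean value inequality for the difference of the two maps turns closeness of the
  derivatives into a Lipschitz bound with a small constant.\<close>

lemma henon_nbhd_lipschitz_close:
  assumes g: "g \<in> henon_nbhd" and x: "p \<in> cball 0 200" "q \<in> cball 0 200"
  shows "norm ((g p - g q) - (henon0 p - henon0 q)) \<le> 3 / 10000 * norm (p - q)"
proof -
  let ?D = "\<lambda>x v. frechet_derivative g (at x) v - frechet_derivative henon0 (at x) v"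
  have "norm ((g p - henon0 p) - (g q - henon0 q)) \<le> 3 / 10000 * norm (p - q)"
  proof (rule differentiable_bound[of "cball 0 200" "\<lambda>x. g x - henon0 x" ?D])
    fix x :: "real^3" assume x: "x \<in> cball 0 200"
    show "((\<lambda>x. g x - henon0 x) has_derivative ?D x) (at x within cball 0 200)"
      using henon_nbhdD(2)[OF g] henon0_differentiable
      by (intro has_derivative_at_withinI[OF has_derivative_diff] frechet_derivative_worksI)
    show "onorm (?D x) \<le> 3 / 10000"
      by (rule onorm_bound) (use henon_nbhd_derivative_close[OF g x] in auto)
  qed (use x in auto)
  then show ?thesis by (simp add: algebra_simps)
qed

definition strip_center :: "bool \<Rightarrow> real^3" where
  "strip_center \<sigma> = vector [0, if \<sigma> then 10 else -10, 0]"

lemma strip_center_nth [simp]: "strip_center \<sigma> $ 1 = 0" "strip_center \<sigma> $ 2 = (if \<sigma> then 10 else -10)" "strip_center \<sigma> $ 3 = 0"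
  by (simp_all add: strip_center_def)

lemma box_in_cball:
  assumes "wnorm (p - strip_center \<sigma>) \<le> 7"
  shows "p \<in> cball 0 200"
proof -
  have "\<bar>p$1\<bar> \<le> 70" "\<bar>p$2\<bar> \<le> 17" "\<bar>p$3\<bar> \<le> 98"
    using assms by (auto simp: wnorm_le_iff split: if_splits)
  then show ?thesis using norm_vec3_le[of p] by simp
qed

text \<open>For the base map these differences vanish exactly, since \<open>p\<^sup>2 - q\<^sup>2 = (p + q) (p - q)\<close> in the
  second coordinate.\<close>

lemma henon_nbhd_difference_components:
  assumes g: "g \<in> henon_nbhd" and pq: "p \<in> cball 0 200" "q \<in> cball 0 200"
  shows "\<bar>(g p - g q)$1 - (3/2 * (p - q)$1 + (p - q)$2)\<bar> \<le> wnorm (p - q) / 100"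
    "\<bar>(g p - g q)$2 - (p$2 + q$2) * (p - q)$2\<bar> \<le> wnorm (p - q) / 100"
    "\<bar>(g p - g q)$3 - (p - q)$2\<bar> \<le> wnorm (p - q) / 100"
proof -
  define r where "r = (g p - g q) - (henon0 p - henon0 q)"
  have "norm r \<le> 3 / 10000 * norm (p - q)"
    unfolding r_def by (rule henon_nbhd_lipschitz_close[OF g pq])
  also have "\<dots> \<le> wnorm (p - q) / 100"
    using norm_le_wnorm[of "p - q"] wnorm_nonneg[of "p - q"] by linarith
  finally have r: "\<bar>r $ i\<bar> \<le> wnorm (p - q) / 100" for i
    using component_le_norm_cart[of r i] by linarith
  have "r$1 = (g p - g q)$1 - (3/2 * (p - q)$1 + (p - q)$2)"
    by (simp add: r_def henon0_def cu_henon_nth right_diff_distrib)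
  moreover have "r$2 = (g p - g q)$2 - (p$2 + q$2) * (p - q)$2"
    by (simp add: r_def henon0_def cu_henon_nth algebra_simps power2_eq_square)
  moreover have "r$3 = (g p - g q)$3 - (p - q)$2"
    by (simp add: r_def henon0_def cu_henon_nth algebra_simps)
  ultimately show
    "\<bar>(g p - g q)$1 - (3/2 * (p - q)$1 + (p - q)$2)\<bar> \<le> wnorm (p - q) / 100"
    "\<bar>(g p - g q)$2 - (p$2 + q$2) * (p - q)$2\<bar> \<le> wnorm (p - q) / 100"
    "\<bar>(g p - g q)$3 - (p - q)$2\<bar> \<le> wnorm (p - q) / 100"
    using r by metis+
qed

lemma henon_nbhd_difference_step:
  assumes g: "g \<in> henon_nbhd" and p: "wnorm (p - strip_center \<sigma>) \<le> 7" and q: "wnorm (q - strip_center \<sigma>) \<le> 7"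
  shows "hyp_step (p - q) (g p - g q)"
proof -
  have "6 \<le> \<bar>p$2 + q$2\<bar>"
    using p q by (auto simp: wnorm_le_iff split: if_splits)
  then show ?thesis unfolding hyp_step_def
    using henon_nbhd_difference_components[OF g box_in_cball[OF p] box_in_cball[OF q]] by blast
qed

lemma henon_nbhd_derivative_components:
  assumes g: "g \<in> henon_nbhd" and p: "p \<in> cball 0 200"
  shows "\<bar>frechet_derivative g (at p) v $ 1 - (3/2 * v$1 + v$2)\<bar> \<le> wnorm v / 100"
    "\<bar>frechet_derivative g (at p) v $ 2 - (2 * p$2) * v$2\<bar> \<le> wnorm v / 100"
    "\<bar>frechet_derivative g (at p) v $ 3 - v$2\<bar> \<le> wnorm v / 100"
proof -
  define r where "r = frechet_derivative g (at p) v - frechet_derivative henon0 (at p) v"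
  have "norm r \<le> 3 / 10000 * norm v"
    unfolding r_def by (rule henon_nbhd_derivative_close[OF g p])
  also have "\<dots> \<le> wnorm v / 100"
    using norm_le_wnorm[of v] wnorm_nonneg[of v] by linarith
  finally have r: "\<bar>r $ i\<bar> \<le> wnorm v / 100" for i
    using component_le_norm_cart[of r i] by linarith
  show "\<bar>frechet_derivative g (at p) v $ 1 - (3/2 * v$1 + v$2)\<bar> \<le> wnorm v / 100"
    "\<bar>frechet_derivative g (at p) v $ 2 - (2 * p$2) * v$2\<bar> \<le> wnorm v / 100"
    "\<bar>frechet_derivative g (at p) v $ 3 - v$2\<bar> \<le> wnorm v / 100"
    using r[of 1] r[of 2] r[of 3] by (simp_all add: r_def henon0_derivative)
qed

lemma henon_nbhd_derivative_step:
  assumes g: "g \<in> henon_nbhd" and p: "wnorm (p - strip_center \<sigma>) \<le> 7"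
  shows "hyp_step v (frechet_derivative g (at p) v)"
proof -
  have "6 \<le> \<bar>2 * p$2\<bar>"
    using p by (auto simp: wnorm_le_iff split: if_splits)
  then show ?thesis unfolding hyp_step_def
    using henon_nbhd_derivative_components[OF g box_in_cball[OF p]] by blast
qed

text \<open>Within radius \<open>7/2\<close> the slope \<open>p$2 + q$2\<close> deviates from its value \<open>m\<close> at the center by at most 7,
  which is less than the share \<open>2/5\<close> of \<open>\<bar>m\<bar> = 20\<close> that \<open>shadowing_orbit\<close> tolerates.\<close>

lemma henon_nbhd_shadowing_lipschitz:
  assumes g: "g \<in> henon_nbhd" and p: "wnorm (p - strip_center \<sigma>) \<le> 7/2" and q: "wnorm (q - strip_center \<sigma>) \<le> 7/2"
  defines "m \<equiv> if \<sigma> then 20 else -20 :: real"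
  shows "\<bar>(g p - g q)$1 - (3/2 * (p - q)$1 + (p - q)$2)\<bar> \<le> wnorm (p - q) / 100 \<and>
        \<bar>(g p - g q)$2 - m * (p - q)$2\<bar> \<le> 2/5 * \<bar>m\<bar> * wnorm (p - q) \<and>
        \<bar>(g p - g q)$3 - (p - q)$2\<bar> \<le> wnorm (p - q) / 100"
proof -
  have pq: "p \<in> cball 0 200" "q \<in> cball 0 200"
    by (rule box_in_cball[of _ \<sigma>], use p q in linarith)+
  note c = henon_nbhd_difference_components[OF g pq]
  have "\<bar>(p$2 + q$2) - m\<bar> \<le> 7"
  proof -
    have "\<bar>(p - strip_center \<sigma>)$2\<bar> \<le> 7/2" "\<bar>(q - strip_center \<sigma>)$2\<bar> \<le> 7/2"
      using p q unfolding wnorm_le_iff by blast+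
    then have "\<bar>p$2 - m/2\<bar> \<le> 7/2" "\<bar>q$2 - m/2\<bar> \<le> 7/2" by (auto simp: m_def split: if_splits)
    then show ?thesis by linarith
  qed
  then have "\<bar>((p$2 + q$2) - m) * (p - q)$2\<bar> \<le> 7 * wnorm (p - q)"
    unfolding abs_mult by (intro mult_mono wnorm_comp) auto
  moreover have e: "(g p - g q)$2 - m * (p - q)$2
      = ((g p - g q)$2 - (p$2 + q$2) * (p - q)$2) + ((p$2 + q$2) - m) * (p - q)$2"
    by (simp add: algebra_simps)
  moreover have "2/5 * \<bar>m\<bar> * wnorm (p - q) = 8 * wnorm (p - q)" by (simp add: m_def)
  ultimately have "\<bar>(g p - g q)$2 - m * (p - q)$2\<bar> \<le> 2/5 * \<bar>m\<bar> * wnorm (p - q)"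
    using c(2) wnorm_nonneg[of "p - q"] by linarith
  then show ?thesis using c by blast
qed

text \<open>The sequence of centers is almost an orbit at the scale of the boxes: its errors are
  about 10 in each coordinate, and the tolerances for radius 3 are \<open>45/4\<close>, \<open>15\<close> and \<open>21/2\<close>.\<close>

lemma orbit_with_itinerary:
  fixes s :: "int \<Rightarrow> bool"
  assumes g: "g \<in> henon_nbhd"
  obtains w where "\<And>n. g (w n) = w (n + 1)" "\<And>n. wnorm (w n - strip_center (s n)) \<le> 3"
proof -
  define m where "m n = (if s n then 20 else -20 :: real)" for n :: int
  have "\<exists>w. (\<forall>n. g (w n) = w (n + 1)) \<and> (\<forall>n. wnorm (w n - strip_center (s n)) \<le> 3)"
  proof (rule shadowing_orbit[of 3 m "\<lambda>n. strip_center (s n)" "\<lambda>n. g"])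
    fix n p q assume "wnorm (p - strip_center (s n)) \<le> 3" "wnorm (q - strip_center (s n)) \<le> 3"
    then show "\<bar>(g p - g q)$1 - (3/2 * (p - q)$1 + (p - q)$2)\<bar> \<le> wnorm (p - q) / 100 \<and>
        \<bar>(g p - g q)$2 - m n * (p - q)$2\<bar> \<le> 2/5 * \<bar>m n\<bar> * wnorm (p - q) \<and>
        \<bar>(g p - g q)$3 - (p - q)$2\<bar> \<le> wnorm (p - q) / 100"
      unfolding m_def by (intro henon_nbhd_shadowing_lipschitz[OF g]) auto
  next
    fix n
    have "strip_center (s n) \<in> cball 0 200" by (rule box_in_cball[of _ "s n"]) (simp add: wnorm_le_iff)
    then have "norm (g (strip_center (s n)) - henon0 (strip_center (s n))) < 1/10000" by (rule henon_nbhdD(4)[OF g])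
    then have a: "\<bar>(g (strip_center (s n)) - henon0 (strip_center (s n)))$i\<bar> \<le> 1/10000" for i
      using component_le_norm_cart[of "g (strip_center (s n)) - henon0 (strip_center (s n))" i] by linarith
    show "\<bar>(g (strip_center (s n)) - strip_center (s (n + 1)))$1\<bar> \<le> 15/4 * 3 \<and>
        \<bar>(g (strip_center (s n)) - strip_center (s (n + 1)))$2\<bar> \<le> \<bar>m n\<bar> * 3 / 4 \<and>
        \<bar>(g (strip_center (s n)) - strip_center (s (n + 1)))$3\<bar> \<le> 7/2 * 3"
    proof -
      have c: "\<bar>strip_center \<sigma> $ 2\<bar> = 10" for \<sigma> by simp
      have "henon0 (strip_center (s n)) $ 1 = strip_center (s n) $ 2" "henon0 (strip_center (s n)) $ 2 = 0"
        "henon0 (strip_center (s n)) $ 3 = strip_center (s n) $ 2" by (auto simp: henon0_def cu_henon_nth)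
      moreover have "\<bar>m n\<bar> = 20" by (simp add: m_def)
      ultimately show ?thesis
        using a[of 1] a[of 2] a[of 3] c[of "s n"] c[of "s (n + 1)"]
        unfolding vector_minus_component strip_center_nth(1,3) by linarith
    qed
  qed (auto simp: m_def)
  then show thesis using that by blast
qed

text \<open>An orbit of one map is almost an orbit of the other, with errors far below those allowed
  for radius \<open>1/25\<close>. This is what keeps the conjugacies between horseshoes close to the identity.\<close>

lemma orbit_near_orbit:
  fixes s :: "int \<Rightarrow> bool"
  assumes f: "f \<in> henon_nbhd" and g: "g \<in> henon_nbhd"
    and v: "\<And>n. f (v n) = v (n + 1)" "\<And>n. wnorm (v n - strip_center (s n)) \<le> 3"
  obtains w where "\<And>n. g (w n) = w (n + 1)" "\<And>n. wnorm (w n - v n) \<le> 1/25"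
proof -
  define m where "m n = (if s n then 20 else -20 :: real)" for n :: int
  have "\<exists>w. (\<forall>n. g (w n) = w (n + 1)) \<and> (\<forall>n. wnorm (w n - v n) \<le> 1/25)"
  proof (rule shadowing_orbit[of "1/25" m v "\<lambda>n. g"])
    fix n p q assume "wnorm (p - v n) \<le> 1/25" "wnorm (q - v n) \<le> 1/25"
    then have "wnorm (p - strip_center (s n)) \<le> 7/2" "wnorm (q - strip_center (s n)) \<le> 7/2"
      using wnorm_diff_triangle[of p "strip_center (s n)" "v n"] wnorm_diff_triangle[of q "strip_center (s n)" "v n"]
        v(2)[of n] by linarith+
    then show "\<bar>(g p - g q)$1 - (3/2 * (p - q)$1 + (p - q)$2)\<bar> \<le> wnorm (p - q) / 100 \<and>
        \<bar>(g p - g q)$2 - m n * (p - q)$2\<bar> \<le> 2/5 * \<bar>m n\<bar> * wnorm (p - q) \<and>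
        \<bar>(g p - g q)$3 - (p - q)$2\<bar> \<le> wnorm (p - q) / 100"
      unfolding m_def by (intro henon_nbhd_shadowing_lipschitz[OF g])
  next
    fix n
    have "v n \<in> cball 0 200" by (rule box_in_cball[of _ "s n"]) (use v(2)[of n] in linarith)
    then have "norm (g (v n) - henon0 (v n)) < 1/10000" "norm (f (v n) - henon0 (v n)) < 1/10000"
      using henon_nbhdD(4) f g by blast+
    then have "norm (g (v n) - f (v n)) \<le> 1/5000"
      using norm_triangle_ineq4[of "g (v n) - henon0 (v n)" "f (v n) - henon0 (v n)"] by simp
    then have a: "\<bar>(g (v n) - v (n + 1))$i\<bar> \<le> 1/5000" for i
      using component_le_norm_cart[of "g (v n) - f (v n)" i] by (simp add: v(1))
    show "\<bar>(g (v n) - v (n + 1))$1\<bar> \<le> 15/4 * (1/25) \<and>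
        \<bar>(g (v n) - v (n + 1))$2\<bar> \<le> \<bar>m n\<bar> * (1/25) / 4 \<and>
        \<bar>(g (v n) - v (n + 1))$3\<bar> \<le> 7/2 * (1/25)"
      using a[of 1] a[of 2] a[of 3] by (simp add: m_def)
  qed (auto simp: m_def)
  then show thesis using that by blast
qed

section \<open>The horseshoe and its symbolic coding\<close>

definition int_iter :: "('a \<Rightarrow> 'a) \<Rightarrow> int \<Rightarrow> 'a \<Rightarrow> 'a" where
  "int_iter g n = (if 0 \<le> n then g ^^ nat n else inv g ^^ nat (- n))"

lemma int_iter_of_nat: "int_iter g (int n) = g ^^ n"
  by (simp add: int_iter_def)

lemma int_iter_minus_of_nat: "int_iter g (- int n) = inv g ^^ n"
  by (cases "n = 0") (auto simp: int_iter_def)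

lemma int_iter_0 [simp]: "int_iter g 0 p = p"
  by (simp add: int_iter_def)

lemma int_iter_step:
  assumes "bij g"
  shows "g (int_iter g n p) = int_iter g (n + 1) p"
proof (cases "0 \<le> n")
  case True
  then have "nat (n + 1) = Suc (nat n)" by simp
  then show ?thesis using True by (simp add: int_iter_def)
next
  case False
  define k where "k = nat (- n) - 1"
  have k: "nat (- n) = Suc k" "n + 1 = - int k" using False by (auto simp: k_def)
  have "int_iter g n p = inv g ((inv g ^^ k) p)" using False by (simp add: int_iter_def k(1))
  moreover have "int_iter g (n + 1) p = (inv g ^^ k) p" unfolding k(2) int_iter_minus_of_nat ..
  ultimately show ?thesis using assms by (simp add: bij_is_surj surj_f_inv_f)
qed

lemma orbit_eq_int_iter:
  assumes "bij g" and w: "\<And>n. g (w n) = w (n + 1)"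
  shows "w n = int_iter g n (w 0)"
proof (induction n rule: int_induct[where k = 0])
  case (step1 i)
  then show ?case using w[of i] int_iter_step[OF assms(1), of i "w 0"] by simp
next
  case (step2 i)
  have "g (w (i - 1)) = g (int_iter g (i - 1) (w 0))"
    using w[of "i - 1"] step2 int_iter_step[OF assms(1), of "i - 1"] by simp
  then show ?case using assms(1) by (simp add: bij_is_inj inj_eq)
qed simp

lemma int_iter_int_iter:
  assumes "bij g"
  shows "int_iter g n (int_iter g k p) = int_iter g (n + k) p"
  using orbit_eq_int_iter[OF assms, of "\<lambda>n. int_iter g (n + k) p" n] int_iter_step[OF assms, of "_ + k" p]
  by (simp add: ac_simps)

lemma int_iter_image_step:
  assumes "bij g"
  shows "int_iter g n (g p) = int_iter g (n + 1) p"
  using int_iter_int_iter[OF assms, of n 1 p] by (simp add: int_iter_def)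

lemma continuous_funpow:
  fixes f :: "'a::topological_space \<Rightarrow> 'a"
  assumes "continuous_on UNIV f"
  shows "continuous_on UNIV (f ^^ n)"
proof (induction n)
  case 0
  then show ?case by (simp add: id_def)
next
  case (Suc n)
  have "continuous_on ((f ^^ n) ` UNIV) f" using assms by (rule continuous_on_subset) simp
  from continuous_on_compose[OF Suc this] show ?case by (simp add: comp_def)
qed

lemma continuous_int_iter:
  assumes "g \<in> henon_nbhd"
  shows "continuous_on UNIV (int_iter g n)"
proof -
  have "continuous_on UNIV g" "continuous_on UNIV (inv g)"
    using henon_nbhdD(2,3)[OF assms]
    by (simp_all add: differentiable_imp_continuous_on differentiable_on_def)
  then show ?thesis unfolding int_iter_def by (auto intro: continuous_funpow)
qed

text \<open>The maximal invariant set in the two boxes of radius 3. Defined in this way it is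
  visibly closed and invariant, and it depends on the map only.\<close>

definition horseshoe :: "(real^3 \<Rightarrow> real^3) \<Rightarrow> (real^3) set" where
  "horseshoe g = {p. \<forall>n. \<exists>\<sigma>. wnorm (int_iter g n p - strip_center \<sigma>) \<le> 3}"

text \<open>The two boxes are separated by the plane \<open>y = 0\<close>.\<close>

definition itinerary :: "(real^3 \<Rightarrow> real^3) \<Rightarrow> real^3 \<Rightarrow> int \<Rightarrow> bool" where
  "itinerary g p n \<longleftrightarrow> 0 < int_iter g n p $ 2"

lemma box_sign:
  assumes "wnorm (p - strip_center \<sigma>) \<le> 7"
  shows "0 < p $ 2 \<longleftrightarrow> \<sigma>" "p $ 2 \<noteq> 0"
  using assms by (auto simp: wnorm_le_iff split: if_splits)

lemma horseshoe_box:
  assumes "p \<in> horseshoe g"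
  shows "wnorm (int_iter g n p - strip_center (itinerary g p n)) \<le> 3"
proof -
  obtain \<sigma> where \<sigma>: "wnorm (int_iter g n p - strip_center \<sigma>) \<le> 3" using assms unfolding horseshoe_def by blast
  then have "itinerary g p n = \<sigma>" using box_sign(1)[of "int_iter g n p" \<sigma>] by (simp add: itinerary_def)
  then show ?thesis using \<sigma> by simp
qed

lemma orbit_horseshoe:
  fixes w :: "int \<Rightarrow> real^3"
  assumes g: "g \<in> henon_nbhd" and w: "\<And>n. g (w n) = w (n + 1)" "\<And>n. wnorm (w n - strip_center (s n)) \<le> 3"
  shows "w 0 \<in> horseshoe g" "itinerary g (w 0) = s"
proof -
  have z: "int_iter g n (w 0) = w n" for n
    using orbit_eq_int_iter[OF henon_nbhdD(1)[OF g], of w n] w(1) by simp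
  show "w 0 \<in> horseshoe g" unfolding horseshoe_def mem_Collect_eq z using w(2) by blast
  have "wnorm (w n - strip_center (s n)) \<le> 7" for n using w(2)[of n] by linarith
  then show "itinerary g (w 0) = s" unfolding itinerary_def z using box_sign(1) by blast
qed

lemma horseshoe_realizes_itinerary:
  assumes "g \<in> henon_nbhd"
  shows "\<exists>p\<in>horseshoe g. itinerary g p = s"
proof -
  obtain w where "\<And>n. g (w n) = w (n + 1)" "\<And>n. wnorm (w n - strip_center (s n)) \<le> 3"
    using orbit_with_itinerary[OF assms] by blast
  then show ?thesis using orbit_horseshoe[OF assms] by blast
qed

text \<open>The larger radius 7 leaves room for points that are only known to be near the horseshoe, such
  as those of a conjugate copy.\<close>

lemma orbit_unique:
  fixes w v :: "int \<Rightarrow> real^3"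
  assumes g: "g \<in> henon_nbhd" and w: "\<And>n. g (w n) = w (n + 1)" "\<And>n. wnorm (w n - strip_center (s n)) \<le> 7"
    and v: "\<And>n. g (v n) = v (n + 1)" "\<And>n. wnorm (v n - strip_center (s n)) \<le> 7"
  shows "w 0 = v 0"
proof -
  have "wnorm (w 0 - v 0) \<le> (3/4) ^ k * 14" for k
  proof (rule window_bound[of k "\<lambda>n. w n - v n"])
    fix n
    show "hyp_step (w n - v n) (w (n + 1) - v (n + 1))"
      using henon_nbhd_difference_step[OF g w(2) v(2), of n] by (simp add: w(1) v(1))
    show "wnorm (w n - v n) \<le> 14"
      using wnorm_diff_triangle[of "w n" "v n" "strip_center (s n)"] w(2)[of n] v(2)[of n]
        wnorm_minus_commute[of "v n" "strip_center (s n)"] by linarith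
  qed
  then have "wnorm (w 0 - v 0) \<le> 0" by (rule geometric_bound_nonpos)
  then have "w 0 - v 0 = 0" by (rule wnorm_eq_0)
  then show ?thesis by simp
qed

lemma itinerary_inj:
  assumes g: "g \<in> henon_nbhd" and p: "p \<in> horseshoe g" and q: "q \<in> horseshoe g" and eq: "itinerary g p = itinerary g q"
  shows "p = q"
proof -
  note b = henon_nbhdD(1)[OF g]
  have "int_iter g 0 p = int_iter g 0 q"
  proof (rule orbit_unique[OF g, of "\<lambda>n. int_iter g n p" "itinerary g p" "\<lambda>n. int_iter g n q"])
    show "wnorm (int_iter g n p - strip_center (itinerary g p n)) \<le> 7" "wnorm (int_iter g n q - strip_center (itinerary g p n)) \<le> 7" for n
      using horseshoe_box[OF p, of n] horseshoe_box[OF q, of n] eq by auto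
  qed (use int_iter_step[OF b] in auto)
  then show ?thesis by simp
qed

lemma itinerary_window_close:
  assumes g: "g \<in> henon_nbhd" and p: "p \<in> horseshoe g" and q: "q \<in> horseshoe g"
    and eq: "\<And>n. - int k \<le> n \<Longrightarrow> n < int k \<Longrightarrow> itinerary g p n = itinerary g q n"
  shows "dist p q \<le> 650 * (3/4) ^ k"
proof -
  note b = henon_nbhdD(1)[OF g]
  have "wnorm (int_iter g 0 p - int_iter g 0 q) \<le> (3/4) ^ k * 26"
  proof (rule window_bound[of k "\<lambda>n. int_iter g n p - int_iter g n q"])
    fix n assume n: "- int k \<le> n" "n < int k"
    have "wnorm (int_iter g n p - strip_center (itinerary g p n)) \<le> 7" "wnorm (int_iter g n q - strip_center (itinerary g p n)) \<le> 7"
      using horseshoe_box[OF p, of n] horseshoe_box[OF q, of n] eq[OF n] by auto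
    from henon_nbhd_difference_step[OF g this]
    show "hyp_step (int_iter g n p - int_iter g n q) (int_iter g (n + 1) p - int_iter g (n + 1) q)"
      by (simp add: int_iter_step[OF b])
  next
    fix n
    have 1: "wnorm (strip_center a - strip_center b) \<le> 20" for a b by (auto simp: wnorm_le_iff)
    show "wnorm (int_iter g n p - int_iter g n q) \<le> 26"
      using wnorm_diff_triangle[of "int_iter g n p" "int_iter g n q" "strip_center (itinerary g p n)"]
        wnorm_diff_triangle[of "strip_center (itinerary g p n)" "int_iter g n q" "strip_center (itinerary g q n)"]
        wnorm_minus_commute[of "int_iter g n q" "strip_center (itinerary g q n)"]
        1[of "itinerary g p n" "itinerary g q n"] horseshoe_box[OF p, of n] horseshoe_box[OF q, of n] by linarith
  qed
  then show ?thesis using norm_le_wnorm[of "p - q"] by (simp add: dist_norm)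
qed

lemma horseshoe_image: 
  assumes g: "g \<in> henon_nbhd"
  shows "g ` horseshoe g = horseshoe g"
proof -
  note b = henon_nbhdD(1)[OF g]
  have 1: "g p \<in> horseshoe g \<longleftrightarrow> p \<in> horseshoe g" for p
  proof -
    have "(\<forall>n::int. P (n + 1)) \<longleftrightarrow> (\<forall>n. P n)" for P
      by (metis diff_add_cancel)
    then show ?thesis unfolding horseshoe_def mem_Collect_eq int_iter_image_step[OF b] .
  qed
  show ?thesis
  proof
    show "g ` horseshoe g \<subseteq> horseshoe g" using 1 by blast
    show "horseshoe g \<subseteq> g ` horseshoe g"
    proof
      fix p assume "p \<in> horseshoe g"
      moreover obtain q where "p = g q" using b by (meson bij_is_surj surjD)
      ultimately show "p \<in> g ` horseshoe g" using 1 by blast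
    qed
  qed
qed

lemma int_iter_horseshoe:
  assumes g: "g \<in> henon_nbhd" and p: "p \<in> horseshoe g"
  shows "int_iter g n p \<in> horseshoe g" "itinerary g (int_iter g n p) k = itinerary g p (k + n)"
  using p unfolding horseshoe_def itinerary_def by (simp_all add: int_iter_int_iter[OF henon_nbhdD(1)[OF g]])

lemma horseshoe_compact:
  assumes g: "g \<in> henon_nbhd"
  shows "compact (horseshoe g)"
proof -
  have "closed {p. wnorm (int_iter g n p - strip_center \<sigma>) \<le> 3}" for n \<sigma>
    unfolding wnorm_def unorm_def snorm_def
    by (intro closed_Collect_le continuous_intros continuous_int_iter[OF g]) auto
  then have "closed ({p. wnorm (int_iter g n p - strip_center True) \<le> 3} \<union> {p. wnorm (int_iter g n p - strip_center False) \<le> 3})" for n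
    by blast
  moreover have "horseshoe g = (\<Inter>n. {p. wnorm (int_iter g n p - strip_center True) \<le> 3} \<union> {p. wnorm (int_iter g n p - strip_center False) \<le> 3})"
    unfolding horseshoe_def ex_bool_eq by blast
  ultimately have "closed (horseshoe g)" by auto
  moreover have "horseshoe g \<subseteq> cball 0 200"
  proof
    fix p assume "p \<in> horseshoe g"
    from horseshoe_box[OF this, of 0] show "p \<in> cball 0 200"
      by (intro box_in_cball[of p "itinerary g p 0"]) simp
  qed
  ultimately show ?thesis by (meson bounded_cball bounded_subset compact_eq_bounded_closed)
qed

definition horseshoe_conj :: "(real^3 \<Rightarrow> real^3) \<Rightarrow> (real^3 \<Rightarrow> real^3) \<Rightarrow> real^3 \<Rightarrow> real^3" where
  "horseshoe_conj f g p = (SOME q. q \<in> horseshoe g \<and> itinerary g q = itinerary f p)"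

lemma horseshoe_conj_props:
  assumes "g \<in> henon_nbhd"
  shows "horseshoe_conj f g p \<in> horseshoe g" "itinerary g (horseshoe_conj f g p) = itinerary f p"
proof -
  have "\<exists>q. q \<in> horseshoe g \<and> itinerary g q = itinerary f p" using horseshoe_realizes_itinerary[OF assms] by blast
  from someI_ex[OF this] show "horseshoe_conj f g p \<in> horseshoe g" "itinerary g (horseshoe_conj f g p) = itinerary f p"
    by (simp_all add: horseshoe_conj_def)
qed

lemma horseshoe_conj_inverse:
  assumes "f \<in> henon_nbhd" "g \<in> henon_nbhd" "p \<in> horseshoe f"
  shows "horseshoe_conj g f (horseshoe_conj f g p) = p"
  by (rule itinerary_inj[OF assms(1) horseshoe_conj_props(1)[OF assms(1)] assms(3)])
     (simp add: horseshoe_conj_props(2)[OF assms(1)] horseshoe_conj_props(2)[OF assms(2)])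

lemma horseshoe_conj_step:
  assumes f: "f \<in> henon_nbhd" and g: "g \<in> henon_nbhd"
  shows "horseshoe_conj f g (f p) = g (horseshoe_conj f g p)"
proof (rule itinerary_inj[OF g])
  show "g (horseshoe_conj f g p) \<in> horseshoe g" using horseshoe_image[OF g] horseshoe_conj_props(1)[OF g] by blast
  show "itinerary g (horseshoe_conj f g (f p)) = itinerary g (g (horseshoe_conj f g p))"
    unfolding horseshoe_conj_props(2)[OF g]
  proof
    fix n
    have "itinerary g (horseshoe_conj f g p) (n + 1) = itinerary f p (n + 1)" by (simp add: horseshoe_conj_props(2)[OF g])
    then show "itinerary f (f p) n = itinerary g (g (horseshoe_conj f g p)) n"
      by (simp add: itinerary_def int_iter_image_step[OF henon_nbhdD(1)[OF g]] int_iter_image_step[OF henon_nbhdD(1)[OF f]])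
  qed
qed (rule horseshoe_conj_props[OF g])

lemma horseshoe_conj_close:
  assumes f: "f \<in> henon_nbhd" and g: "g \<in> henon_nbhd" and p: "p \<in> horseshoe f"
  shows "dist (horseshoe_conj f g p) p \<le> 1"
proof -
  note bf = henon_nbhdD(1)[OF f] and bg = henon_nbhdD(1)[OF g]
  obtain w where w: "\<And>n. g (w n) = w (n + 1)" "\<And>n. wnorm (w n - int_iter f n p) \<le> 1/25"
    using orbit_near_orbit[OF f g, of "\<lambda>n. int_iter f n p" "itinerary f p"] int_iter_step[OF bf] horseshoe_box[OF p]
    by blast
  have "w 0 = int_iter g 0 (horseshoe_conj f g p)"
  proof (rule orbit_unique[OF g, of w "itinerary f p" "\<lambda>n. int_iter g n (horseshoe_conj f g p)"])
    fix n
    show "wnorm (w n - strip_center (itinerary f p n)) \<le> 7"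
      using wnorm_diff_triangle[of "w n" "strip_center (itinerary f p n)" "int_iter f n p"] w(2)[of n] horseshoe_box[OF p, of n]
      by linarith
    show "wnorm (int_iter g n (horseshoe_conj f g p) - strip_center (itinerary f p n)) \<le> 7"
      using horseshoe_box[OF horseshoe_conj_props(1)[OF g], of n f p] by (simp add: horseshoe_conj_props(2)[OF g])
  qed (use w(1) int_iter_step[OF bg] in auto)
  then have "wnorm (horseshoe_conj f g p - p) \<le> 1/25" using w(2)[of 0] by simp
  then show ?thesis using norm_le_wnorm[of "horseshoe_conj f g p - p"] by (simp add: dist_norm)
qed

text \<open>Each symbol is the sign of a continuous function that does not vanish on the horseshoe.\<close>

lemma itinerary_locally_constant:
  assumes f: "f \<in> henon_nbhd" and p: "p \<in> horseshoe f"
  shows "\<forall>\<^sub>F q in at p. \<forall>n\<in>{- int k..<int k}. q \<in> horseshoe f \<longrightarrow> itinerary f q n = itinerary f p n"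
proof (rule eventually_ball_finite)
  show "\<forall>n\<in>{- int k..<int k}. \<forall>\<^sub>F q in at p. q \<in> horseshoe f \<longrightarrow> itinerary f q n = itinerary f p n"
  proof
    fix n
    have lim: "((\<lambda>q. int_iter f n q $ 2) \<longlongrightarrow> int_iter f n p $ 2) (at p)"
      using continuous_int_iter[OF f, of n]
      by (intro tendsto_vec_nth) (simp add: continuous_on_eq_continuous_at isContD)
    have ne: "int_iter f n p $ 2 \<noteq> 0"
      using box_sign(2)[of "int_iter f n p" "itinerary f p n"] horseshoe_box[OF p, of n] by linarith
    show "\<forall>\<^sub>F q in at p. q \<in> horseshoe f \<longrightarrow> itinerary f q n = itinerary f p n"
    proof (cases "0 < int_iter f n p $ 2")
      case True
      then show ?thesis using order_tendstoD(1)[OF lim, of 0]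
        by (auto simp: itinerary_def elim: eventually_mono)
    next
      case False
      then have "int_iter f n p $ 2 < 0" using ne by simp
      then show ?thesis using order_tendstoD(2)[OF lim, of 0] False
        by (auto simp: itinerary_def elim!: eventually_mono)
    qed
  qed
qed simp

lemma horseshoe_conj_continuous:
  assumes f: "f \<in> henon_nbhd" and g: "g \<in> henon_nbhd"
  shows "continuous_on (horseshoe f) (horseshoe_conj f g)"
  unfolding continuous_on_def
proof (intro ballI tendstoI)
  fix p and e :: real assume p: "p \<in> horseshoe f" and e: "0 < e"
  have "(\<lambda>k. 650 * (3/4::real) ^ k) \<longlonglongrightarrow> 0"
    by (intro tendsto_mult_right_zero LIMSEQ_power_zero) auto
  from order_tendstoD(2)[OF this e] obtain k where k: "650 * (3/4::real) ^ k < e"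
    by (auto simp: eventually_sequentially)
  have ev: "\<forall>\<^sub>F q in at p within horseshoe f. \<forall>n\<in>{- int k..<int k}. q \<in> horseshoe f \<longrightarrow> itinerary f q n = itinerary f p n"
    using itinerary_locally_constant[OF f p, of k] by (meson at_le filter_leD subset_UNIV)
  moreover have "\<forall>\<^sub>F q in at p within horseshoe f. q \<in> horseshoe f"
    by (simp add: eventually_at_filter)
  ultimately show "\<forall>\<^sub>F q in at p within horseshoe f. dist (horseshoe_conj f g q) (horseshoe_conj f g p) < e"
  proof eventually_elim
    case (elim q)
    have "dist (horseshoe_conj f g q) (horseshoe_conj f g p) \<le> 650 * (3/4) ^ k"
      by (rule itinerary_window_close[OF g]) (use elim in \<open>auto simp: horseshoe_conj_props[OF g]\<close>)
    then show ?case using k by linarith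
  qed
qed

lemma horseshoe_conjugate_copy:
  assumes f: "f \<in> henon_nbhd" and g: "g \<in> henon_nbhd"
  shows "conjugate_copy 1 f (horseshoe f) g (horseshoe g)"
proof -
  have "homeomorphism (horseshoe f) (horseshoe g) (horseshoe_conj f g) (horseshoe_conj g f)"
    by (intro homeomorphismI horseshoe_conj_continuous f g)
       (auto simp: horseshoe_conj_props(1)[OF f] horseshoe_conj_props(1)[OF g] horseshoe_conj_inverse[OF f g] horseshoe_conj_inverse[OF g f])
  then show ?thesis unfolding conjugate_copy_def using horseshoe_conj_close[OF f g] horseshoe_conj_step[OF f g] by blast
qed

text \<open>A conjugacy that moves points by at most 1 cannot change the itinerary, since orbits stay in the
  boxes of radius 4; by \<open>orbit_unique\<close> it agrees with \<open>horseshoe_conj\<close>.\<close>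

lemma horseshoe_conjugate_copy_unique:
  assumes f: "f \<in> henon_nbhd" and g: "g \<in> henon_nbhd" and c: "conjugate_copy 1 f (horseshoe f) g \<Lambda>'"
  shows "\<Lambda>' = horseshoe g"
proof -
  note bf = henon_nbhdD(1)[OF f] and bg = henon_nbhdD(1)[OF g]
  obtain h h' where h: "homeomorphism (horseshoe f) \<Lambda>' h h'"
    "\<And>x. x \<in> horseshoe f \<Longrightarrow> dist (h x) x \<le> 1" "\<And>x. x \<in> horseshoe f \<Longrightarrow> h (f x) = g (h x)"
    using c unfolding conjugate_copy_def by blast
  have "h p = horseshoe_conj f g p" if p: "p \<in> horseshoe f" for p
  proof -
    note z = int_iter_horseshoe(1)[OF f p]
    have "h (int_iter f 0 p) = int_iter g 0 (horseshoe_conj f g p)"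
    proof (rule orbit_unique[OF g, of "\<lambda>n. h (int_iter f n p)" "itinerary f p" "\<lambda>n. int_iter g n (horseshoe_conj f g p)"])
      fix n
      have "wnorm (h (int_iter f n p) - int_iter f n p) \<le> 1"
        using h(2)[OF z[of n]] wnorm_le_norm[of "h (int_iter f n p) - int_iter f n p"] by (simp add: dist_norm)
      then show "wnorm (h (int_iter f n p) - strip_center (itinerary f p n)) \<le> 7"
        using wnorm_diff_triangle[of "h (int_iter f n p)" "strip_center (itinerary f p n)" "int_iter f n p"] horseshoe_box[OF p, of n]
        by linarith
      show "wnorm (int_iter g n (horseshoe_conj f g p) - strip_center (itinerary f p n)) \<le> 7"
        using horseshoe_box[OF horseshoe_conj_props(1)[OF g], of n f p] by (simp add: horseshoe_conj_props(2)[OF g])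
      show "g (h (int_iter f n p)) = h (int_iter f (n + 1) p)"
        using h(3)[OF z[of n]] by (simp add: int_iter_step[OF bf])
    qed (use int_iter_step[OF bg] in auto)
    then show ?thesis by simp
  qed
  then have "h ` horseshoe f = horseshoe_conj f g ` horseshoe f" by (simp add: image_def)
  also have "\<dots> = horseshoe g"
  proof
    show "horseshoe_conj f g ` horseshoe f \<subseteq> horseshoe g" using horseshoe_conj_props(1)[OF g] by blast
    show "horseshoe g \<subseteq> horseshoe_conj f g ` horseshoe f"
    proof
      fix q assume "q \<in> horseshoe g"
      then have "q = horseshoe_conj f g (horseshoe_conj g f q)" using horseshoe_conj_inverse[OF g f] by simp
      then show "q \<in> horseshoe_conj f g ` horseshoe f" using horseshoe_conj_props(1)[OF f] by blast
    qed
  qed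
  finally show ?thesis using h(1) by (simp add: homeomorphism_def)
qed

text \<open>The block of positions from \<open>2\<^sup>m\<close> to \<open>2\<^sup>m\<^sup>+\<^sup>1 - 1\<close> lists the binary digits of \<open>m\<close>. Every finite word
  occurs as the first digits of some \<open>m\<close>; an additional digit 1 at position \<open>k\<close> ensures \<open>m \<ge> 2\<^sup>k\<close>, so that
  the block is long enough.\<close>

lemma universal_sequence:
  obtains s :: "nat \<Rightarrow> bool" where "\<And>k t. \<exists>n. \<forall>j<k. s (n + j) = t j"
proof -
  define s where "s n = (n - 2 ^ floor_log n \<in> set_decode (floor_log n))" for n :: nat
  have "\<exists>n. \<forall>j<k. s (n + j) = t j" for k and t :: "nat \<Rightarrow> bool"
  proof -
    define A where "A = insert k {j. j < k \<and> t j}"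
    define m where "m = set_encode A"
    have A: "set_decode m = A" unfolding m_def by (rule set_encode_inverse) (simp add: A_def)
    have "(2::nat) ^ k \<le> m"
      unfolding m_def set_encode_def by (rule member_le_sum) (auto simp: A_def)
    then have km: "k < 2 ^ m"
      by (meson less_exp less_le_trans order_less_trans)
    have "s (2 ^ m + j) = t j" if j: "j < k" for j
    proof -
      have "floor_log (2 ^ m + j) = m" using j km by (intro floor_log_eqI) auto
      then show ?thesis using j by (simp add: s_def A) (simp add: A_def)
    qed
    then show ?thesis by blast
  qed
  then show thesis using that by blast
qed

text \<open>The point whose forward itinerary is universal has a dense forward orbit.\<close>

lemma horseshoe_transitive:
  assumes g: "g \<in> henon_nbhd"
  shows "transitive_set g (horseshoe g)"
proof -
  note b = henon_nbhdD(1)[OF g]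
  obtain s :: "nat \<Rightarrow> bool" where s: "\<And>k t. \<exists>n. \<forall>j<k. s (n + j) = t j"
    using universal_sequence by blast
  obtain p where p: "p \<in> horseshoe g" "itinerary g p = (\<lambda>n. s (nat n))"
    using horseshoe_realizes_itinerary[OF g] by blast
  have orb: "(g ^^ n) p \<in> horseshoe g" for n
    using int_iter_horseshoe(1)[OF g p(1), of "int n"] by (simp add: int_iter_of_nat)
  have "closure (range (\<lambda>n. (g ^^ n) p)) = horseshoe g"
  proof
    show "closure (range (\<lambda>n. (g ^^ n) p)) \<subseteq> horseshoe g"
      using orb horseshoe_compact[OF g] by (intro closure_minimal) (auto simp: compact_imp_closed)
    show "horseshoe g \<subseteq> closure (range (\<lambda>n. (g ^^ n) p))"
    proof
      fix q assume q: "q \<in> horseshoe g"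
      show "q \<in> closure (range (\<lambda>n. (g ^^ n) p))"
        unfolding closure_approachable
      proof (intro allI impI)
        fix e :: real assume e: "0 < e"
        have "(\<lambda>k. 650 * (3/4::real) ^ k) \<longlonglongrightarrow> 0"
          by (intro tendsto_mult_right_zero LIMSEQ_power_zero) auto
        from order_tendstoD(2)[OF this e] obtain k where k: "650 * (3/4::real) ^ k < e"
          by (auto simp: eventually_sequentially)
        obtain n where n: "\<And>j. j < 2 * k \<Longrightarrow> s (n + j) = itinerary g q (int j - int k)"
          using s[of "2 * k" "\<lambda>j. itinerary g q (int j - int k)"] by blast
        have "dist ((g ^^ (n + k)) p) q \<le> 650 * (3/4) ^ k"
        proof (rule itinerary_window_close[OF g orb q])
          fix i :: int assume i: "- int k \<le> i" "i < int k"
          define j where "j = nat (i + int k)"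
          have j: "j < 2 * k" "i = int j - int k" using i by (auto simp: j_def)
          have "itinerary g ((g ^^ (n + k)) p) i = itinerary g p (i + int (n + k))"
            using int_iter_horseshoe(2)[OF g p(1), of "int (n + k)" i] by (simp only: int_iter_of_nat)
          also have "i + int (n + k) = int (n + j)" using j(2) by simp
          also have "itinerary g p (int (n + j)) = s (n + j)" unfolding p(2) by (simp only: nat_int)
          finally show "itinerary g ((g ^^ (n + k)) p) i = itinerary g q i" using n[OF j(1)] j(2) by simp
        qed
        then have "dist ((g ^^ (n + k)) p) q < e" using k by linarith
        then show "\<exists>y\<in>range (\<lambda>n. (g ^^ n) p). dist y q < e" by blast
      qed
    qed
  qed
  then show ?thesis unfolding transitive_set_def using p(1) by blast
qed

section \<open>The hyperbolic splitting\<close>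

lemma wnorm_scaleR: "wnorm (c *\<^sub>R v) = \<bar>c\<bar> * wnorm v"
  by (simp add: wnorm_def unorm_def snorm_def max_mult_distrib_left abs_mult)

lemma differentiable_funpow:
  fixes f :: "'a::real_normed_vector \<Rightarrow> 'a"
  assumes "\<And>x. f differentiable (at x)"
  shows "(f ^^ n) differentiable (at x)"
proof (induction n arbitrary: x)
  case (Suc n)
  show ?case using differentiable_chain_at[OF Suc assms] by (simp add: comp_def)
qed (simp add: id_def)

lemma frechet_derivative_funpow_Suc:
  fixes f :: "'a::real_normed_vector \<Rightarrow> 'a"
  assumes "\<And>x. f differentiable (at x)"
  shows "frechet_derivative (f ^^ Suc n) (at x) v
      = frechet_derivative f (at ((f ^^ n) x)) (frechet_derivative (f ^^ n) (at x) v)"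
    "frechet_derivative (f ^^ Suc n) (at x) v
      = frechet_derivative (f ^^ n) (at (f x)) (frechet_derivative f (at x) v)"
proof -
  note d = differentiable_funpow[OF assms]
  show "frechet_derivative (f ^^ Suc n) (at x) v
      = frechet_derivative f (at ((f ^^ n) x)) (frechet_derivative (f ^^ n) (at x) v)"
    using frechet_derivative_compose[OF d[of n x] assms] by simp
  show "frechet_derivative (f ^^ Suc n) (at x) v
      = frechet_derivative (f ^^ n) (at (f x)) (frechet_derivative f (at x) v)"
    using frechet_derivative_compose[OF assms d] by (simp add: funpow_Suc_right del: funpow.simps)
qed

lemma frechet_derivative_inv:
  assumes "g \<in> henon_nbhd"
  shows "frechet_derivative (inv g) (at (g x)) (frechet_derivative g (at x) v) = v"
    "frechet_derivative g (at x) (frechet_derivative (inv g) (at (g x)) v) = v"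
proof -
  note b = henon_nbhdD(1)[OF assms] and d = henon_nbhdD(2,3)[OF assms]
  have id: "inv g \<circ> g = id" "g \<circ> inv g = id"
    using b by (simp_all add: bij_is_inj fun_eq_iff bij_is_surj surj_f_inv_f)
  have ix: "inv g (g x) = x" using b by (simp add: bij_is_inj)
  have "frechet_derivative (inv g \<circ> g) (at x) v = v" unfolding id by (simp add: frechet_derivative_id id_def)
  then show "frechet_derivative (inv g) (at (g x)) (frechet_derivative g (at x) v) = v"
    unfolding frechet_derivative_compose[OF d(1) d(2)] by simp
  have "frechet_derivative (g \<circ> inv g) (at (g x)) v = v" unfolding id by (simp add: frechet_derivative_id id_def)
  then show "frechet_derivative g (at x) (frechet_derivative (inv g) (at (g x)) v) = v"
    unfolding frechet_derivative_compose[OF d(2) d(1)] by (simp add: ix)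
qed

text \<open>For a map \<open>g\<close> and its inverse these are the stable and the unstable space; the description by
  boundedness makes invariance and the subspace property automatic.\<close>

definition bounded_vectors :: "(real^3 \<Rightarrow> real^3) \<Rightarrow> real^3 \<Rightarrow> (real^3) set" where
  "bounded_vectors f x = {v. \<exists>B. \<forall>n. wnorm (frechet_derivative (f ^^ n) (at x) v) \<le> B}"

lemma subspace_bounded_vectors:
  assumes d: "\<And>x. f differentiable (at x)"
  shows "subspace (bounded_vectors f x)"
proof -
  have lin: "linear (frechet_derivative (f ^^ n) (at x))" for n
    by (rule linear_frechet_derivative[OF differentiable_funpow[OF d]])
  show ?thesis
  proof (rule subspaceI)
    show "0 \<in> bounded_vectors f x"
      unfolding bounded_vectors_def mem_Collect_eq linear_0[OF lin]
      by (intro exI[of _ 0]) (simp add: wnorm_le_iff)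
  next
    fix v w assume "v \<in> bounded_vectors f x" "w \<in> bounded_vectors f x"
    then obtain A B where AB: "\<And>n. wnorm (frechet_derivative (f ^^ n) (at x) v) \<le> A"
      "\<And>n. wnorm (frechet_derivative (f ^^ n) (at x) w) \<le> B"
      unfolding bounded_vectors_def by blast
    have "wnorm (frechet_derivative (f ^^ n) (at x) (v + w)) \<le> A + B" for n
      using wnorm_triangle[of "frechet_derivative (f ^^ n) (at x) v" "frechet_derivative (f ^^ n) (at x) w"]
        AB[of n] unfolding linear_add[OF lin] by linarith
    then show "v + w \<in> bounded_vectors f x" unfolding bounded_vectors_def by blast
  next
    fix c v assume "v \<in> bounded_vectors f x"
    then obtain A where "\<And>n. wnorm (frechet_derivative (f ^^ n) (at x) v) \<le> A"
      unfolding bounded_vectors_def by blast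
    then have "wnorm (frechet_derivative (f ^^ n) (at x) (c *\<^sub>R v)) \<le> \<bar>c\<bar> * A" for n
      unfolding linear_cmul[OF lin] wnorm_scaleR by (simp add: mult_left_mono)
    then show "c *\<^sub>R v \<in> bounded_vectors f x" unfolding bounded_vectors_def by blast
  qed
qed

lemma bounded_vectors_step:
  assumes d: "\<And>x. f differentiable (at x)"
  shows "frechet_derivative f (at x) v \<in> bounded_vectors f (f x) \<longleftrightarrow> v \<in> bounded_vectors f x"
proof -
  let ?D = "\<lambda>n. wnorm (frechet_derivative (f ^^ n) (at x) v)"
  have "frechet_derivative f (at x) v \<in> bounded_vectors f (f x) \<longleftrightarrow> (\<exists>B. \<forall>n. ?D (Suc n) \<le> B)"
    unfolding bounded_vectors_def mem_Collect_eq frechet_derivative_funpow_Suc(2)[OF d] ..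
  also have "\<dots> \<longleftrightarrow> (\<exists>B. \<forall>n. ?D n \<le> B)"
  proof
    assume "\<exists>B. \<forall>n. ?D (Suc n) \<le> B"
    then obtain B where B: "\<And>n. ?D (Suc n) \<le> B" by blast
    have "?D n \<le> max B (?D 0)" for n
    proof (cases n)
      case (Suc k)
      then show ?thesis using B[of k] by (simp only: le_max_iff_disj simp_thms)
    qed (simp only: le_max_iff_disj order_refl simp_thms)
    then show "\<exists>B. \<forall>n. ?D n \<le> B" by blast
  qed blast
  finally show ?thesis unfolding bounded_vectors_def mem_Collect_eq .
qed

lemma bounded_vectors_image:
  assumes g: "g \<in> henon_nbhd"
  shows "frechet_derivative g (at x) ` bounded_vectors g x = bounded_vectors g (g x)"
    "frechet_derivative g (at x) ` bounded_vectors (inv g) x = bounded_vectors (inv g) (g x)"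
proof -
  note d = henon_nbhdD(2,3)[OF g] and i = frechet_derivative_inv[OF g]
  have ix: "inv g (g x) = x" using henon_nbhdD(1)[OF g] by (simp add: bij_is_inj)
  have 1: "frechet_derivative g (at x) v \<in> bounded_vectors g (g x) \<longleftrightarrow> v \<in> bounded_vectors g x" for v
    by (rule bounded_vectors_step[OF d(1)])
  have 2: "frechet_derivative g (at x) v \<in> bounded_vectors (inv g) (g x) \<longleftrightarrow> v \<in> bounded_vectors (inv g) x" for v
    using bounded_vectors_step[OF d(2), of "g x" "frechet_derivative g (at x) v"] by (simp add: i ix)
  have image: "frechet_derivative g (at x) ` S = T"
    if "\<And>v. frechet_derivative g (at x) v \<in> T \<longleftrightarrow> v \<in> S" for S T
  proof
    show "frechet_derivative g (at x) ` S \<subseteq> T" using that by auto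
    show "T \<subseteq> frechet_derivative g (at x) ` S"
    proof
      fix w assume w: "w \<in> T"
      have e: "w = frechet_derivative g (at x) (frechet_derivative (inv g) (at (g x)) w)"
        by (rule i(2)[symmetric])
      moreover have "frechet_derivative (inv g) (at (g x)) w \<in> S"
        unfolding that[symmetric] i(2) by (rule w)
      ultimately show "w \<in> frechet_derivative g (at x) ` S" by (rule image_eqI)
    qed
  qed
  show "frechet_derivative g (at x) ` bounded_vectors g x = bounded_vectors g (g x)"
    by (rule image) (rule 1)
  show "frechet_derivative g (at x) ` bounded_vectors (inv g) x = bounded_vectors (inv g) (g x)"
    by (rule image) (rule 2)
qed

lemma horseshoe_forward_derivative_step:
  assumes g: "g \<in> henon_nbhd" and x: "x \<in> horseshoe g"
  shows "hyp_step (frechet_derivative (g ^^ n) (at x) v) (frechet_derivative (g ^^ Suc n) (at x) v)"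
proof -
  have "wnorm ((g ^^ n) x - strip_center (itinerary g x (int n))) \<le> 7"
    using horseshoe_box[OF x, of "int n"] unfolding int_iter_of_nat by linarith
  then show ?thesis
    unfolding frechet_derivative_funpow_Suc(1)[OF henon_nbhdD(2)[OF g]]
    by (rule henon_nbhd_derivative_step[OF g])
qed

lemma horseshoe_backward_derivative_step:
  assumes g: "g \<in> henon_nbhd" and x: "x \<in> horseshoe g"
  shows "hyp_step (frechet_derivative (inv g ^^ Suc n) (at x) v) (frechet_derivative (inv g ^^ n) (at x) v)"
proof -
  define z where "z = (inv g ^^ Suc n) x"
  have "wnorm (z - strip_center (itinerary g x (- int (Suc n)))) \<le> 7"
    using horseshoe_box[OF x, of "- int (Suc n)"] unfolding int_iter_minus_of_nat z_def by linarith
  from henon_nbhd_derivative_step[OF g this, of "frechet_derivative (inv g ^^ Suc n) (at x) v"]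
  have "hyp_step (frechet_derivative (inv g ^^ Suc n) (at x) v)
     (frechet_derivative g (at z) (frechet_derivative (inv g ^^ Suc n) (at x) v))" .
  moreover have gz: "(inv g ^^ n) x = g z"
    using henon_nbhdD(1)[OF g] by (simp add: z_def bij_is_surj surj_f_inv_f)
  have "frechet_derivative g (at z) (frechet_derivative (inv g ^^ Suc n) (at x) v)
      = frechet_derivative (inv g ^^ n) (at x) v"
    unfolding frechet_derivative_funpow_Suc(1)[OF henon_nbhdD(3)[OF g]] gz
    by (rule frechet_derivative_inv(2)[OF g])
  ultimately show ?thesis by simp
qed

lemma stable_vectors:
  assumes g: "g \<in> henon_nbhd" and x: "x \<in> horseshoe g" and v: "v \<in> bounded_vectors g x"
  shows "unorm v \<le> snorm v / 50"
    "norm (frechet_derivative (g ^^ n) (at x) v) \<le> 25 * (3/4) ^ n * norm v"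
proof -
  let ?d = "\<lambda>n. frechet_derivative (g ^^ n) (at x) v"
  obtain B where B: "\<And>n. wnorm (?d n) \<le> B" using v unfolding bounded_vectors_def by blast
  have d0: "?d 0 = v" by (simp add: id_def frechet_derivative_ident)
  note st = horseshoe_forward_derivative_step[OF g x]
  show "unorm v \<le> snorm v / 50"
    using forward_bounded_stable_cone[of ?d B 0, OF st B] unfolding d0 .
  have "norm (?d n) \<le> 25 * wnorm (?d n)" by (rule norm_le_wnorm)
  also have "\<dots> \<le> 25 * ((3/4) ^ n * wnorm v)"
    using forward_bounded_contraction[of ?d B n, OF st B] unfolding d0 by simp
  also have "\<dots> \<le> 25 * ((3/4) ^ n * norm v)"
    using wnorm_le_norm[of v] by (intro mult_left_mono) auto
  finally show "norm (?d n) \<le> 25 * (3/4) ^ n * norm v" by (simp add: mult.assoc)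
qed

lemma unstable_vectors:
  assumes g: "g \<in> henon_nbhd" and x: "x \<in> horseshoe g" and v: "v \<in> bounded_vectors (inv g) x"
  shows "snorm v \<le> unorm v"
    "norm (frechet_derivative (inv g ^^ n) (at x) v) \<le> 25 * (3/4) ^ n * norm v"
proof -
  let ?d = "\<lambda>n. frechet_derivative (inv g ^^ n) (at x) v"
  obtain B where B: "\<And>n. wnorm (?d n) \<le> B" using v unfolding bounded_vectors_def by blast
  have d0: "?d 0 = v" by (simp add: id_def frechet_derivative_ident)
  note st = horseshoe_backward_derivative_step[OF g x]
  show "snorm v \<le> unorm v"
    using backward_bounded_unstable_cone[of ?d B 0, OF st B] unfolding d0 .
  have "norm (?d n) \<le> 25 * wnorm (?d n)" by (rule norm_le_wnorm)
  also have "\<dots> \<le> 25 * ((3/4) ^ n * wnorm v)"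
    using backward_bounded_contraction[of ?d B n, OF st B] unfolding d0 by simp
  also have "\<dots> \<le> 25 * ((3/4) ^ n * norm v)"
    using wnorm_le_norm[of v] by (intro mult_left_mono) auto
  finally show "norm (?d n) \<le> 25 * (3/4) ^ n * norm v" by (simp add: mult.assoc)
qed

text \<open>Insert the given vector \<open>w\<close> as an inhomogeneity at time \<open>-1\<close> into the linearized recursion
  along the orbit of \<open>x\<close>. A bounded solution \<open>p\<close> is a homogeneous bounded orbit from time 0 on and up to
  time \<open>-1\<close>, and \<open>w\<close> is the jump between the two halves, \<open>w = p 0 - A (-1) (p (-1))\<close>.\<close>

lemma stable_unstable_decomposition:
  assumes g: "g \<in> henon_nbhd" and x: "x \<in> horseshoe g"
  obtains a b where "a \<in> bounded_vectors g x" "b \<in> bounded_vectors (inv g) x" "w = a + b"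
proof -
  note bg = henon_nbhdD(1)[OF g] and d = henon_nbhdD(2,3)[OF g]
  define A where "A n = frechet_derivative g (at (int_iter g n x))" for n
  have lin: "linear (A n)" for n unfolding A_def by (rule linear_frechet_derivative[OF d(1)])
  (* affine maps whose only inhomogeneous term is w, at the step from time -1 to time 0 *)
  define f where "f n p = A n p + (if n = -1 then w else 0)" for n p
  define m where "m n = 2 * int_iter g n x $ 2" for n
  have box: "wnorm (int_iter g n x - strip_center (itinerary g x n)) \<le> 3" for n by (rule horseshoe_box[OF x])
  have m: "10 \<le> \<bar>m n\<bar>" for n
    using box[of n] by (auto simp: m_def wnorm_le_iff split: if_splits)
  have "\<exists>p. (\<forall>n. f n (p n) = p (n + 1)) \<and> (\<forall>n. wnorm (p n - 0) \<le> norm w)"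
  proof (rule shadowing_orbit[of "norm w" m "\<lambda>n. 0" f])
    show "10 \<le> \<bar>m n\<bar>" for n by (rule m)
  next
    fix n p q
    have "f n p - f n q = A n (p - q)" by (simp add: f_def linear_diff[OF lin])
    moreover have "int_iter g n x \<in> cball 0 200"
      by (rule box_in_cball[of _ "itinerary g x n"]) (use box[of n] in linarith)
    from henon_nbhd_derivative_components[OF g this, of "p - q"]
    have "\<bar>A n (p - q) $ 1 - (3/2 * (p - q)$1 + (p - q)$2)\<bar> \<le> wnorm (p - q) / 100"
      "\<bar>A n (p - q) $ 2 - m n * (p - q)$2\<bar> \<le> wnorm (p - q) / 100"
      "\<bar>A n (p - q) $ 3 - (p - q)$2\<bar> \<le> wnorm (p - q) / 100"
      unfolding A_def m_def .
    moreover have "wnorm (p - q) / 100 \<le> 2/5 * \<bar>m n\<bar> * wnorm (p - q)"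
      using mult_right_mono[of "1/100" "2/5 * \<bar>m n\<bar>" "wnorm (p - q)"] m[of n] by simp
    ultimately show "\<bar>(f n p - f n q)$1 - (3/2 * (p - q)$1 + (p - q)$2)\<bar> \<le> wnorm (p - q) / 100 \<and>
        \<bar>(f n p - f n q)$2 - m n * (p - q)$2\<bar> \<le> 2/5 * \<bar>m n\<bar> * wnorm (p - q) \<and>
        \<bar>(f n p - f n q)$3 - (p - q)$2\<bar> \<le> wnorm (p - q) / 100"
      by simp
  next
    fix n
    have c: "\<bar>w$i\<bar> \<le> norm w" for i by (rule component_le_norm_cart)
    have "10 * norm w \<le> \<bar>m n\<bar> * norm w" using m[of n] by (intro mult_right_mono) auto
    then show "\<bar>(f n 0 - 0)$1\<bar> \<le> 15/4 * norm w \<and>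
        \<bar>(f n 0 - 0)$2\<bar> \<le> \<bar>m n\<bar> * norm w / 4 \<and> \<bar>(f n 0 - 0)$3\<bar> \<le> 7/2 * norm w"
      using c[of 1] c[of 2] c[of 3] norm_ge_zero[of w]
      unfolding f_def linear_0[OF lin] by (auto simp del: norm_ge_zero)
  qed auto
  then obtain p where p: "\<And>n. f n (p n) = p (n + 1)" "\<And>n. wnorm (p n) \<le> norm w" by auto
  have step: "A n (p n) = p (n + 1)" if "n \<noteq> -1" for n
    using p(1)[of n] that by (simp add: f_def)
  have fwd: "frechet_derivative (g ^^ n) (at x) (p 0) = p (int n)" for n
  proof (induction n)
    case 0
    then show ?case by (simp add: id_def frechet_derivative_ident)
  next
    case (Suc n)
    have "A (int n) (p (int n)) = p (int n + 1)" by (rule step) simp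
    then show ?case
      unfolding frechet_derivative_funpow_Suc(1)[OF d(1)] Suc
      by (simp add: A_def int_iter_of_nat add.commute)
  qed
  then have 1: "p 0 \<in> bounded_vectors g x" unfolding bounded_vectors_def using p(2) by auto
  define z where "z = int_iter g (-1) x"
  have gz: "g z = x" unfolding z_def using int_iter_step[OF bg, of "-1" x] by simp
  have bwd: "frechet_derivative (inv g ^^ n) (at z) (p (-1)) = p (- 1 - int n)" for n
  proof (induction n)
    case 0
    then show ?case by (simp add: id_def frechet_derivative_ident)
  next
    case (Suc n)
    define y where "y = int_iter g (- 1 - int (Suc n)) x"
    have "(inv g ^^ n) z = int_iter g (- 1 - int n) x"
      using int_iter_int_iter[OF bg, of "- int n" "-1" x] by (simp add: z_def int_iter_minus_of_nat add.commute)
    also have "\<dots> = g y" unfolding y_def using int_iter_step[OF bg, of "- 1 - int (Suc n)" x] by simp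
    finally have zy: "(inv g ^^ n) z = g y" .
    have "A (- 1 - int (Suc n)) (p (- 1 - int (Suc n))) = p (- 1 - int n)"
      by (subst step) auto
    then show ?case
      unfolding frechet_derivative_funpow_Suc(1)[OF d(2)] Suc zy
      using frechet_derivative_inv(1)[OF g, of y "p (- 1 - int (Suc n))"] by (simp add: A_def y_def)
  qed
  then have "p (-1) \<in> bounded_vectors (inv g) z" unfolding bounded_vectors_def using p(2) by auto
  then have "A (-1) (p (-1)) \<in> bounded_vectors (inv g) x"
    using bounded_vectors_image(2)[OF g, of z] unfolding gz A_def z_def[symmetric] by blast
  then have 2: "- A (-1) (p (-1)) \<in> bounded_vectors (inv g) x"
    by (rule subspace_neg[OF subspace_bounded_vectors[OF d(2)]])
  have "w = p 0 + (- A (-1) (p (-1)))" 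
  proof -
    have "p 0 = A (-1) (p (-1)) + w" using p(1)[of "-1"] by (simp add: f_def)
    then show ?thesis by (simp only: add_diff_cancel_left' flip: diff_conv_add_uminus)
  qed
  then show thesis by (rule that[OF 1 2])
qed

lemma horseshoe_hyperbolic_splitting:
  assumes g: "g \<in> henon_nbhd"
  shows "hyperbolic_splitting g (horseshoe g) (bounded_vectors g) (bounded_vectors (inv g))"
proof -
  note d = henon_nbhdD(2,3)[OF g]
  have int0: "bounded_vectors g x \<inter> bounded_vectors (inv g) x = {0}" if x: "x \<in> horseshoe g" for x
  proof -
    have "v = 0" if v: "v \<in> bounded_vectors g x" "v \<in> bounded_vectors (inv g) x" for v
    proof -
      have "unorm v \<le> 0" "snorm v \<le> 0"
        using stable_vectors(1)[OF g x v(1)] unstable_vectors(1)[OF g x v(2)] unorm_nonneg[of v]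
        by linarith+
      then show ?thesis by (intro wnorm_eq_0) (simp add: wnorm_def)
    qed
    moreover have "0 \<in> bounded_vectors g x" "0 \<in> bounded_vectors (inv g) x"
      using subspace_0[OF subspace_bounded_vectors[OF d(1)]] subspace_0[OF subspace_bounded_vectors[OF d(2)]]
      by simp_all
    ultimately show ?thesis by blast
  qed
  have sum: "{a + b |a b. a \<in> bounded_vectors g x \<and> b \<in> bounded_vectors (inv g) x} = UNIV"
    if x: "x \<in> horseshoe g" for x
  proof (rule UNIV_eq_I[symmetric])
    fix w
    obtain a b where "a \<in> bounded_vectors g x" "b \<in> bounded_vectors (inv g) x" "w = a + b"
      using stable_unstable_decomposition[OF g x] .
    then show "w \<in> {a + b |a b. a \<in> bounded_vectors g x \<and> b \<in> bounded_vectors (inv g) x}" by blast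
  qed
  show ?thesis
    unfolding hyperbolic_splitting_def
  (* the pattern for P gives the two existential quantifiers different witnesses *)
  proof (intro conjI exI[where P = "\<lambda>C. \<exists>\<theta>. _ C \<theta>" and x = 25] exI[where x = "3/4"] ballI allI)
    fix x assume x: "x \<in> horseshoe g"
    show "subspace (bounded_vectors g x)" "subspace (bounded_vectors (inv g) x)"
      by (intro subspace_bounded_vectors d)+
    show "norm (frechet_derivative (g ^^ n) (at x) v) \<le> 25 * (3 / 4) ^ n * norm v"
      if "v \<in> bounded_vectors g x" for n v using stable_vectors(2)[OF g x that] .
    show "norm (frechet_derivative (inv g ^^ n) (at x) v) \<le> 25 * (3 / 4) ^ n * norm v"
      if "v \<in> bounded_vectors (inv g) x" for n v using unstable_vectors(2)[OF g x that] .
  qed (simp_all add: int0 sum bounded_vectors_image[OF g])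
qed

text \<open>The cones bound both dimensions from above: the stable space meets the plane
  \<open>z = 0\<close> only in 0, and the unstable space meets the \<open>z\<close> axis only in 0. As the dimensions add up to
  3, they are 1 and 2.\<close>

lemma dim_bounded_vectors_inv:
  assumes g: "g \<in> henon_nbhd" and x: "x \<in> horseshoe g"
  shows "dim (bounded_vectors (inv g) x) = 2"
proof -
  let ?S = "bounded_vectors g x" and ?U = "bounded_vectors (inv g) x"
  let ?e = "axis 3 1 :: real^3"
  note d = henon_nbhdD(2,3)[OF g]
  have sub: "subspace ?S" "subspace ?U" by (intro subspace_bounded_vectors d)+
  have sp: "?S \<inter> ?U = {0}" "{a + b |a b. a \<in> ?S \<and> b \<in> ?U} = UNIV"
    using bspec[OF conjunct1[OF horseshoe_hyperbolic_splitting[OF g, unfolded hyperbolic_splitting_def]] x]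
    by simp_all
  have 1: "dim ?S + dim ?U = 3"
    using dim_sums_Int[OF sub] by (simp add: sp)
  have "?S \<inter> {v. ?e \<bullet> v = 0} \<subseteq> {0}"
  proof
    fix v assume v: "v \<in> ?S \<inter> {v. ?e \<bullet> v = 0}"
    then have "snorm v = 0" by (simp add: snorm_def inner_axis')
    then have "wnorm v \<le> 0" using stable_vectors(1)[OF g x, of v] v by (simp add: wnorm_def)
    then show "v \<in> {0}" using wnorm_eq_0 by simp
  qed
  then have "dim (?S \<inter> {v. ?e \<bullet> v = 0}) = 0" by (simp add: dim_eq_0)
  moreover have "dim {v. ?e \<bullet> v = 0} = 2" by (subst dim_hyperplane) auto
  moreover have "dim {a + b |a b. a \<in> ?S \<and> b \<in> {v. ?e \<bullet> v = 0}} \<le> 3"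
    using dim_subset_UNIV[of "{a + b |a b. a \<in> ?S \<and> b \<in> {v. ?e \<bullet> v = 0}}"] by simp
  ultimately have 2: "dim ?S \<le> 1"
    using dim_sums_Int[OF sub(1) subspace_hyperplane[of ?e]] by linarith
  have "?U \<inter> span {?e} \<subseteq> {0}"
  proof
    fix v assume v: "v \<in> ?U \<inter> span {?e}"
    then obtain c where "v = c *\<^sub>R ?e" unfolding span_singleton by blast
    then have "unorm v = 0" by (simp add: unorm_def axis_def)
    then have "wnorm v \<le> 0" using unstable_vectors(1)[OF g x, of v] v by (simp add: wnorm_def)
    then show "v \<in> {0}" using wnorm_eq_0 by simp
  qed
  then have "dim (?U \<inter> span {?e}) = 0" by (simp add: dim_eq_0)
  moreover have "dim (span {?e}) = 1" by simp
  moreover have "dim {a + b |a b. a \<in> ?U \<and> b \<in> span {?e}} \<le> 3"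
    using dim_subset_UNIV[of "{a + b |a b. a \<in> ?U \<and> b \<in> span {?e}}"] by simp
  ultimately have 3: "dim ?U \<le> 2"
    using dim_sums_Int[OF sub(2) subspace_span[of "{?e}"]] by linarith
  show ?thesis using 1 2 3 by linarith
qed

lemma horseshoe_hyperbolic:
  assumes "g \<in> henon_nbhd"
  shows "hyperbolic_set g (horseshoe g)" "has_index g (horseshoe g) 2"
proof -
  show "hyperbolic_set g (horseshoe g)" unfolding hyperbolic_set_def
    using horseshoe_compact[OF assms] horseshoe_image[OF assms] horseshoe_hyperbolic_splitting[OF assms] by blast
  show "has_index g (horseshoe g) 2" unfolding has_index_def
    using horseshoe_hyperbolic_splitting[OF assms] dim_bounded_vectors_inv[OF assms] by blast
qed

section \<open>Local stable sets and vertical disks\<close>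

text \<open>Points within 4 of a point in a box of radius 3 lie in the box of radius 7, so orbits that
  stay 4-close follow the same itinerary and the dichotomy applies to their difference.\<close>

lemma horseshoe_stable_size:
  assumes g: "g \<in> henon_nbhd"
  shows "stable_size g 4 (horseshoe g)"
  unfolding stable_size_def
  (* the pattern for P gives the two existential quantifiers different witnesses *)
proof (intro conjI exI[where P = "\<lambda>C. \<exists>\<theta>. _ C \<theta>" and x = 25] exI[where x = "3/4"] ballI allI)
  fix x y n assume x: "x \<in> horseshoe g" and y: "y \<in> stable_at g 4 x"
  define d where "d n = (g ^^ n) x - (g ^^ n) y" for n
  have d4: "wnorm (d n) \<le> 4" for n
    using y wnorm_le_norm[of "d n"] by (force simp: stable_at_def d_def dist_norm intro: order_trans)
  have "hyp_step (d n) (d (Suc n))" for n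
  proof -
    have 1: "wnorm ((g ^^ n) x - strip_center (itinerary g x (int n))) \<le> 3"
      using horseshoe_box[OF x, of "int n"] by (simp add: int_iter_of_nat)
    have 2: "wnorm ((g ^^ n) y - strip_center (itinerary g x (int n))) \<le> 7"
      using wnorm_diff_triangle[of "(g ^^ n) y" "strip_center (itinerary g x (int n))" "(g ^^ n) x"] 1 d4[of n]
        wnorm_minus_commute[of "(g ^^ n) y" "(g ^^ n) x"] unfolding d_def by linarith
    have "wnorm ((g ^^ n) x - strip_center (itinerary g x (int n))) \<le> 7" using 1 by linarith
    from henon_nbhd_difference_step[OF g this 2] show ?thesis by (simp add: d_def)
  qed
  from forward_bounded_contraction[of d 4 n, OF this d4]
  have "wnorm (d n) \<le> (3/4) ^ n * wnorm (d 0)" .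
  also have "\<dots> \<le> (3/4) ^ n * norm (d 0)"
    using wnorm_le_norm[of "d 0"] by (intro mult_left_mono) auto
  finally show "dist ((g ^^ n) x) ((g ^^ n) y) \<le> 25 * (3/4) ^ n * dist x y"
    using norm_le_wnorm[of "d n"] by (simp add: d_def dist_norm)
qed simp_all

text \<open>Prescribe the symbol \<open>True\<close> for all negative times. Then the point \<open>x\<close> of the horseshoe
  has third coordinate close to the second coordinate of its preimage, hence within about 3 of 10, and so
  within \<open>36/10\<close> of that of \<open>z\<close>. The difference lies in the narrow stable cone, so this bounds its norm by
  4, and later differences are smaller.\<close>

lemma forward_itinerary_in_local_stable:
  assumes g: "g \<in> henon_nbhd" and z: "\<And>n. wnorm ((g ^^ n) z - strip_center (t n)) \<le> 7"
    and z3: "\<bar>z $ 3 - 10\<bar> \<le> 1/2"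
  shows "z \<in> local_stable g 4 (horseshoe g)"
proof -
  note b = henon_nbhdD(1)[OF g]
  obtain x where x: "x \<in> horseshoe g" "itinerary g x = (\<lambda>n. if 0 \<le> n then t (nat n) else True)"
    using horseshoe_realizes_itinerary[OF g] by blast
  define d where "d n = (g ^^ n) x - (g ^^ n) z" for n
  have x7: "wnorm ((g ^^ n) x - strip_center (t n)) \<le> 7" for n
    using horseshoe_box[OF x(1), of "int n"] by (simp add: int_iter_of_nat x(2))
  have st: "hyp_step (d n) (d (Suc n))" for n
    using henon_nbhd_difference_step[OF g x7 z, of n] by (simp add: d_def)
  have bd: "wnorm (d n) \<le> 14" for n
    using wnorm_diff_triangle[of "(g ^^ n) x" "(g ^^ n) z" "strip_center (t n)"] x7[of n] z[of n]
        wnorm_minus_commute[of "(g ^^ n) z" "strip_center (t n)"] unfolding d_def by linarith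
  have cone: "unorm (d n) \<le> snorm (d n) / 50" for n
    using forward_bounded_stable_cone[of d 14 n, OF st bd] .
  have x3: "\<bar>x $ 3 - 10\<bar> \<le> 31/10"
  proof -
    define p where "p = int_iter g (-1) x"
    have p: "wnorm (p - strip_center True) \<le> 3" using horseshoe_box[OF x(1), of "-1"] by (simp add: p_def x(2))
    then have "\<bar>p $ 2 - 10\<bar> \<le> 3" by (simp add: wnorm_le_iff)
    moreover have "p \<in> cball 0 200" by (rule box_in_cball[of _ True]) (use p in linarith)
    then have "norm (g p - henon0 p) < 1/10000" by (rule henon_nbhdD(4)[OF g])
    then have "\<bar>(g p - henon0 p) $ 3\<bar> < 1/10000"
      using component_le_norm_cart[of "g p - henon0 p" 3] by linarith
    moreover have "g p = x" using int_iter_step[OF b, of "-1" x] by (simp add: p_def)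
    ultimately have "\<bar>x $ 3 - p $ 2\<bar> < 1/10000" "\<bar>p $ 2 - 10\<bar> \<le> 3"
      by (simp_all add: henon0_def cu_henon_nth)
    then show ?thesis by linarith
  qed
  have "\<bar>d 0 $ 3\<bar> \<le> 36/10" using x3 z3 unfolding d_def funpow_0 vector_minus_component by linarith
  then have s0: "snorm (d 0) \<le> 36/140" by (simp add: snorm_def)
  have "dist ((g ^^ n) x) ((g ^^ n) z) \<le> 4" for n
  proof -
    have "wnorm (d n) \<le> (3/4) ^ n * wnorm (d 0)"
      using forward_bounded_contraction[of d 14 n, OF st bd] .
    also have "\<dots> \<le> 1 * wnorm (d 0)" by (intro mult_right_mono power_le_one) auto
    also have "\<dots> = snorm (d 0)"
    proof -
      have "unorm (d 0) \<le> snorm (d 0)" using cone[of 0] snorm_nonneg[of "d 0"] by linarith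
      then show ?thesis by (simp add: wnorm_def)
    qed
    finally have "snorm (d n) \<le> 36/140" using s0 by (simp add: wnorm_def)
    moreover have "\<bar>d n $ 1\<bar> \<le> 10 * unorm (d n)" "\<bar>d n $ 2\<bar> \<le> unorm (d n)" "\<bar>d n $ 3\<bar> = 14 * snorm (d n)"
      by (auto simp: unorm_def snorm_def)
    ultimately have "norm (d n) \<le> 4" using norm_vec3_le[of "d n"] cone[of n] by linarith
    then show ?thesis by (simp add: d_def dist_norm)
  qed
  then show ?thesis using x(1) unfolding local_stable_def stable_at_def by blast
qed

text \<open>Curves in a cone around the \<open>y\<close> axis that cross both strips completely, at positions \<open>x\<close> in
  the interval \<open>[-16, 16]\<close>. The parameter interval is given by unordered end points because
  the branch of \<open>y\<^sup>2 - 100\<close> with negative \<open>y\<close> reverses the direction of the curve.\<close>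

definition vertical_curve :: "(real \<Rightarrow> real^3) \<Rightarrow> real \<Rightarrow> real \<Rightarrow> bool" where
  "vertical_curve c a b \<longleftrightarrow> continuous_on (closed_segment a b) c \<and> inj_on c (closed_segment a b) \<and>
     (\<forall>t\<in>closed_segment a b. \<forall>t'\<in>closed_segment a b.
        \<bar>(c t - c t') $ 1\<bar> \<le> \<bar>(c t - c t') $ 2\<bar> / 10 \<and> \<bar>(c t - c t') $ 3\<bar> \<le> \<bar>(c t - c t') $ 2\<bar>) \<and>
     c a $ 2 \<le> -11 \<and> 11 \<le> c b $ 2 \<and>
     (\<forall>t\<in>closed_segment a b. \<bar>c t $ 1\<bar> \<le> 16 \<and> \<bar>c t $ 3\<bar> \<le> 12)"

text \<open>In the cone, equal \<open>y\<close> coordinates force equal points.\<close>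

lemma vertical_curve_height:
  assumes "vertical_curve c a b"
  shows "continuous_on (closed_segment a b) (\<lambda>t. c t $ 2)" "inj_on (\<lambda>t. c t $ 2) (closed_segment a b)"
proof -
  show "continuous_on (closed_segment a b) (\<lambda>t. c t $ 2)"
    using assms unfolding vertical_curve_def by (intro continuous_intros) auto
  show "inj_on (\<lambda>t. c t $ 2) (closed_segment a b)"
  proof (rule inj_onI)
    fix t t' assume t: "t \<in> closed_segment a b" "t' \<in> closed_segment a b" and eq: "c t $ 2 = c t' $ 2"
    have "\<bar>(c t - c t') $ 1\<bar> \<le> \<bar>(c t - c t') $ 2\<bar> / 10 \<and> \<bar>(c t - c t') $ 3\<bar> \<le> \<bar>(c t - c t') $ 2\<bar>"
      using assms t unfolding vertical_curve_def by blast
    then have "c t = c t'" using eq by (simp add: vec_eq_iff forall_3)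
    then show "t = t'" using assms t unfolding vertical_curve_def inj_on_def by blast
  qed
qed

text \<open>The heart of the blender. The strip is chosen so that the new position \<open>3/2 x + y\<close> stays in
  \<open>[-16, 16]\<close>. If \<open>x \<ge> -3\<close> on the part of the curve over the strip \<open>y \<approx> -10\<close>, then \<open>3/2 x + y\<close> lies there
  between \<open>-9/2 - 11\<close> and \<open>24 - 9\<close>. Otherwise \<open>x < -3\<close> at some point of that part; along the strips the curve moves by
  at most \<open>22/10\<close> in \<open>x\<close>, so \<open>x \<le> 0\<close> over the strip \<open>y \<approx> 10\<close>, where \<open>3/2 x + y\<close> is then between
  \<open>-24 + 9\<close> and \<open>11\<close>.\<close>

lemma vertical_curve_step:
  assumes g: "g \<in> henon_nbhd" and c: "vertical_curve c a b"
  obtains a' b' \<sigma> where "closed_segment a' b' \<subseteq> closed_segment a b"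
    "\<And>t. t \<in> closed_segment a' b' \<Longrightarrow> wnorm (c t - strip_center \<sigma>) \<le> 7"
    "vertical_curve (\<lambda>t. g (c t)) a' b'"
proof -
  let ?S = "closed_segment a b"
  have cone: "\<bar>(c t - c t') $ 1\<bar> \<le> \<bar>(c t - c t') $ 2\<bar> / 10" "\<bar>(c t - c t') $ 3\<bar> \<le> \<bar>(c t - c t') $ 2\<bar>"
    if "t \<in> ?S" "t' \<in> ?S" for t t'
    using c that unfolding vertical_curve_def by blast+
  have ends: "c a $ 2 \<le> -11" "11 \<le> c b $ 2" and cc: "continuous_on ?S c" and ci: "inj_on c ?S"
    using c unfolding vertical_curve_def by blast+
  have bounds: "\<bar>c t $ 1\<bar> \<le> 16" "\<bar>c t $ 3\<bar> \<le> 12" if "t \<in> ?S" for t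
    using c that unfolding vertical_curve_def by blast+
  note h = vertical_curve_height[OF c]
  (* choice of the strip: the lower one unless the curve is clearly to the left there *)
  define \<sigma> where "\<sigma> \<longleftrightarrow> (\<exists>t\<in>?S. \<bar>c t $ 2 + 10\<bar> \<le> 1 \<and> c t $ 1 < -3)"
  define \<eta> where "\<eta> = (if \<sigma> then 10 else -10 :: real)"
  have hit: "\<exists>t\<in>?S. c t $ 2 = y" if "\<bar>y\<bar> \<le> 11" for y
  proof -
    have "y \<in> closed_segment (c a $ 2) (c b $ 2)"
      using that ends by (auto simp: closed_segment_eq_real_ivl)
    then show ?thesis using continuous_injective_image_segment_1[OF h] by force
  qed
  (* at y = 9/10 \<eta> and y = 11/10 \<eta> the base map has y-values -19 and 21, for either sign of \<eta> *)
  obtain a' b' where a': "a' \<in> ?S" "c a' $ 2 = 9/10 * \<eta>" and b': "b' \<in> ?S" "c b' $ 2 = 11/10 * \<eta>"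
  proof -
    have "\<bar>9/10 * \<eta>\<bar> \<le> 11" "\<bar>11/10 * \<eta>\<bar> \<le> 11" by (simp_all add: \<eta>_def)
    from hit[OF this(1)] hit[OF this(2)] show thesis using that by blast
  qed
  let ?T = "closed_segment a' b'"
  have sub: "?T \<subseteq> ?S" using a' b' by (simp add: subset_closed_segment)
  have strip: "\<bar>c t $ 2 - \<eta>\<bar> \<le> 1" if "t \<in> ?T" for t
  proof -
    have "c t $ 2 \<in> closed_segment (c a' $ 2) (c b' $ 2)"
      using continuous_injective_image_segment_1[OF continuous_on_subset[OF h(1) sub]
          inj_on_subset[OF h(2) sub]] that by blast
    then show ?thesis unfolding a' b' by (auto simp: closed_segment_eq_real_ivl \<eta>_def split: if_splits)
  qed
  have box: "wnorm (c t - strip_center \<sigma>) \<le> 7" if "t \<in> ?T" for t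
  proof -
    have "(c t - strip_center \<sigma>) $ 2 = c t $ 2 - \<eta>" by (simp add: \<eta>_def)
    then show ?thesis
      using strip[OF that] bounds[of t] sub that unfolding wnorm_le_iff by auto
  qed
  have close: "\<bar>g (c t) $ 1 - (3/2 * c t $ 1 + c t $ 2)\<bar> \<le> 1/10000"
      "\<bar>g (c t) $ 2 - ((c t $ 2)\<^sup>2 - 100)\<bar> \<le> 1/10000"
      "\<bar>g (c t) $ 3 - c t $ 2\<bar> \<le> 1/10000" if "t \<in> ?T" for t
  proof -
    have "norm (g (c t) - henon0 (c t)) < 1/10000"
      by (rule henon_nbhdD(4)[OF g box_in_cball[OF box[OF that]]])
    then have "\<bar>(g (c t) - henon0 (c t)) $ i\<bar> \<le> 1/10000" for i
      using component_le_norm_cart[of "g (c t) - henon0 (c t)" i] by linarith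
    from this[of 1] this[of 2] this[of 3] show "\<bar>g (c t) $ 1 - (3/2 * c t $ 1 + c t $ 2)\<bar> \<le> 1/10000"
      "\<bar>g (c t) $ 2 - ((c t $ 2)\<^sup>2 - 100)\<bar> \<le> 1/10000" "\<bar>g (c t) $ 3 - c t $ 2\<bar> \<le> 1/10000"
      by (simp_all add: henon0_def cu_henon_nth)
  qed
  have "vertical_curve (\<lambda>t. g (c t)) a' b'"
    unfolding vertical_curve_def
  proof (intro conjI ballI)
    have "continuous_on UNIV g"
      using henon_nbhdD(2)[OF g] by (simp add: differentiable_imp_continuous_on differentiable_on_def)
    then have "continuous_on (c ` ?T) g" by (rule continuous_on_subset) simp
    then show "continuous_on ?T (\<lambda>t. g (c t))"
      by (rule continuous_on_compose2[OF _ continuous_on_subset[OF cc sub]]) simp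
    show "inj_on (\<lambda>t. g (c t)) ?T"
      using inj_on_subset[OF ci sub] henon_nbhdD(1)[OF g] by (auto simp: inj_on_def bij_def inj_def)
  next
    fix t t' assume t: "t \<in> ?T" "t' \<in> ?T"
    define \<Delta> where "\<Delta> = c t - c t'"
    have \<Delta>: "\<bar>\<Delta> $ 1\<bar> \<le> \<bar>\<Delta> $ 2\<bar> / 10" "\<bar>\<Delta> $ 3\<bar> \<le> \<bar>\<Delta> $ 2\<bar>"
      unfolding \<Delta>_def using cone t sub by blast+
    then have w: "wnorm \<Delta> \<le> \<bar>\<Delta> $ 2\<bar>" unfolding wnorm_le_iff by auto
    note comp = henon_nbhd_difference_components[OF g box_in_cball[OF box[OF t(1)]] box_in_cball[OF box[OF t(2)]],
        folded \<Delta>_def]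
    have "18 \<le> \<bar>c t $ 2 + c t' $ 2\<bar>"
      using strip[OF t(1)] strip[OF t(2)] by (auto simp: \<eta>_def split: if_splits)
    then have "18 * \<bar>\<Delta> $ 2\<bar> \<le> \<bar>(c t $ 2 + c t' $ 2) * \<Delta> $ 2\<bar>"
      unfolding abs_mult by (rule mult_right_mono) simp
    then have 2: "17 * \<bar>\<Delta> $ 2\<bar> \<le> \<bar>(g (c t) - g (c t')) $ 2\<bar>"
      using comp(2) w by linarith
    show "\<bar>(g (c t) - g (c t')) $ 1\<bar> \<le> \<bar>(g (c t) - g (c t')) $ 2\<bar> / 10"
      using comp(1) \<Delta> w 2 by linarith
    show "\<bar>(g (c t) - g (c t')) $ 3\<bar> \<le> \<bar>(g (c t) - g (c t')) $ 2\<bar>"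
      using comp(3) \<Delta> w 2 by linarith
  next
    have "(c a' $ 2)\<^sup>2 = 81" "(c b' $ 2)\<^sup>2 = 121" unfolding a' b' by (simp_all add: \<eta>_def power2_eq_square)
    moreover have "a' \<in> ?T" "b' \<in> ?T" by simp_all
    ultimately show "g (c a') $ 2 \<le> -11" "11 \<le> g (c b') $ 2"
      using close(2)[of a'] close(2)[of b'] by linarith+
  next
    fix t assume t: "t \<in> ?T"
    then have tS: "t \<in> ?S" using sub by blast
    show "\<bar>g (c t) $ 3\<bar> \<le> 12"
    proof -
      have "\<bar>\<eta>\<bar> = 10" by (simp add: \<eta>_def)
      then show ?thesis using close(3)[OF t] strip[OF t] by linarith
    qed
    show "\<bar>g (c t) $ 1\<bar> \<le> 16"
    proof (cases \<sigma>)
      case False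
      then have "\<bar>c t $ 2 + 10\<bar> \<le> 1" using strip[OF t] by (simp add: \<eta>_def)
      moreover from this have "-3 \<le> c t $ 1" using False tS unfolding \<sigma>_def by force
      ultimately show ?thesis using close(1)[OF t] bounds(1)[OF tS] by linarith
    next
      case True
      then obtain t0 where t0: "t0 \<in> ?S" "\<bar>c t0 $ 2 + 10\<bar> \<le> 1" "c t0 $ 1 < -3"
        unfolding \<sigma>_def by blast
      have y: "\<bar>c t $ 2 - 10\<bar> \<le> 1" using strip[OF t] True by (simp add: \<eta>_def)
      have "10 * \<bar>c t $ 1 - c t0 $ 1\<bar> \<le> \<bar>c t $ 2 - c t0 $ 2\<bar>" using cone(1)[OF tS t0(1)] by simp
      moreover have "\<bar>c t $ 2 - c t0 $ 2\<bar> \<le> 22" using y t0(2) by linarith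
      ultimately have "c t $ 1 \<le> 0" using t0(3) by argo
      then show ?thesis using close(1)[OF t] bounds(1)[OF tS] y by linarith
    qed
  qed
  then show thesis using that sub box by blast
qed

text \<open>Repeated application of \<open>vertical_curve_step\<close> gives nested parameter intervals; a
  parameter in their intersection has its whole forward orbit in the boxes.\<close>

lemma vertical_curve_meets_local_stable:
  assumes g: "g \<in> henon_nbhd" and c: "vertical_curve c a b"
    and c3: "\<And>t. t \<in> closed_segment a b \<Longrightarrow> \<bar>c t $ 3 - 10\<bar> \<le> 1/2"
  shows "\<exists>t\<in>closed_segment a b. c t \<in> local_stable g 4 (horseshoe g)"
proof -
  define Q where "Q n ab \<longleftrightarrow> vertical_curve (\<lambda>t. (g ^^ n) (c t)) (fst ab) (snd ab) \<and>
      closed_segment (fst ab) (snd ab) \<subseteq> closed_segment a b" for n and ab :: "real \<times> real"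
  define R where "R n ab ab' \<longleftrightarrow> closed_segment (fst ab') (snd ab') \<subseteq> closed_segment (fst ab) (snd ab) \<and>
      (\<exists>\<sigma>. \<forall>t\<in>closed_segment (fst ab') (snd ab'). wnorm ((g ^^ n) (c t) - strip_center \<sigma>) \<le> 7)"
    for n and ab ab' :: "real \<times> real"
  have "\<exists>f. \<forall>n. Q n (f n) \<and> R n (f n) (f (Suc n))"
  proof (rule dependent_nat_choice)
    show "\<exists>x. Q 0 x" by (rule exI[of _ "(a, b)"]) (simp add: Q_def c)
  next
    fix ab n assume Q: "Q n ab"
    then obtain a' b' \<sigma> where 1: "closed_segment a' b' \<subseteq> closed_segment (fst ab) (snd ab)"
      "\<And>t. t \<in> closed_segment a' b' \<Longrightarrow> wnorm ((g ^^ n) (c t) - strip_center \<sigma>) \<le> 7"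
      "vertical_curve (\<lambda>t. g ((g ^^ n) (c t))) a' b'"
      using vertical_curve_step[OF g] unfolding Q_def by blast
    have "Q (Suc n) (a', b')" using 1 Q by (auto simp: Q_def)
    moreover have "R n ab (a', b')" using 1 by (auto simp: R_def)
    ultimately show "\<exists>ab'. Q (Suc n) ab' \<and> R n ab ab'" by blast
  qed
  then obtain f where f: "\<And>n. Q n (f n)" "\<And>n. R n (f n) (f (Suc n))" by blast
  let ?F = "\<lambda>n. closed_segment (fst (f n)) (snd (f n))"
  have "decseq ?F" using f(2) by (intro decseq_SucI) (simp add: R_def)
  then have "\<Inter> (range ?F) \<noteq> {}"
    by (intro compact_nest) (auto simp: decseq_def)
  then obtain t where t: "\<And>n. t \<in> ?F n" by auto
  have "\<exists>\<sigma>. wnorm ((g ^^ n) (c t) - strip_center \<sigma>) \<le> 7" for n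
    using f(2)[of n] t[of "Suc n"] unfolding R_def by blast
  then obtain \<tau> where "\<And>n. wnorm ((g ^^ n) (c t) - strip_center (\<tau> n)) \<le> 7" by metis
  moreover have "t \<in> closed_segment a b" using f(1)[of 0] t[of 0] unfolding Q_def by blast
  ultimately show ?thesis using forward_itinerary_in_local_stable[OF g] c3 by blast
qed

text \<open>The third coordinate 10 is close to that of all points of the horseshoe whose preimage lies
  in the strip around \<open>y = 10\<close>.\<close>

definition vertical_disk :: "real \<Rightarrow> real^3" where
  "vertical_disk t = vector [0, 13 * t, 10]"

text \<open>Asking for closeness with some \<open>e < 1/20\<close>, rather than with \<open>1/20\<close> itself, makes openness immediate.\<close>

definition blender_disks :: "(real \<Rightarrow> real^3) set" where
  "blender_disks = {\<phi>. C1_disk_embedding \<phi> \<and> (\<exists>e<1/20. C1_disk_close e \<phi> vertical_disk)}"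

lemma vertical_disk_has_derivative:
  "(vertical_disk has_derivative (\<lambda>v. vector [0, 13 * v, 0])) (at x within S)"
proof -
  have "((\<lambda>t. vertical_disk t $ i) has_derivative (\<lambda>v. (vector [0, 13 * v, 0] :: real^3) $ i)) (at x within S)" for i :: 3
  proof -
    consider "i = 1" | "i = 2" | "i = 3" using exhaust_3 by blast
    then show ?thesis
      by cases (auto simp: vertical_disk_def intro!: derivative_eq_intros)
  qed
  then show ?thesis
    by (subst has_derivative_componentwise_within) (auto simp: Basis_vec_def inner_axis)
qed

lemma disk_deriv_vertical_disk:
  assumes "x \<in> cball 0 1"
  shows "disk_deriv vertical_disk x = (\<lambda>v. vector [0, 13 * v, 0])"
proof -
  have "cball (0::real) 1 = cbox (-1) 1" by (auto simp: dist_real_def)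
  then show ?thesis
    unfolding disk_deriv_def using assms
    by (simp only:) (rule frechet_derivative_within_cbox[OF _ _ vertical_disk_has_derivative], auto)
qed

lemma C1_disk_embedding_vertical_disk: "C1_disk_embedding vertical_disk"
  unfolding C1_disk_embedding_def
proof (intro conjI ballI)
  have "t = t'" if "vertical_disk t = vertical_disk t'" for t t'
    using arg_cong[OF that, of "\<lambda>p. p $ 2"] by (simp add: vertical_disk_def)
  then show "inj_on vertical_disk (cball 0 1)" by (simp add: inj_on_def)
  fix x :: real assume x: "x \<in> cball 0 1"
  show "vertical_disk differentiable (at x within cball 0 1)"
    using vertical_disk_has_derivative differentiableI by blast
  have "t = t'" if "(vector [0, 13 * t, 0] :: real^3) = vector [0, 13 * t', 0]" for t t' :: real
    using arg_cong[OF that, of "\<lambda>p. p $ 2"] by simp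
  then show "inj (disk_deriv vertical_disk x)" unfolding disk_deriv_vertical_disk[OF x] inj_def by blast
next
  fix v :: real
  show "continuous_on (cball 0 1) (\<lambda>x. disk_deriv vertical_disk x v)"
    using disk_deriv_vertical_disk by (subst continuous_on_cong[OF refl, of _ _ "\<lambda>x. vector [0, 13 * v, 0]"]) auto
qed

lemma C1_disk_close_trans:
  assumes "C1_disk_close e \<phi> \<psi>" "C1_disk_close e' \<psi> \<omega>"
  shows "C1_disk_close (e + e') \<phi> \<omega>"
  unfolding C1_disk_close_def
proof (intro ballI conjI)
  fix x :: 'a assume x: "x \<in> cball 0 1"
  have "norm (\<phi> x - \<psi> x) < e" "norm (\<psi> x - \<omega> x) < e'"
    using assms x unfolding C1_disk_close_def by blast+
  then show "norm (\<phi> x - \<omega> x) < e + e'"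
    using norm_triangle_ineq[of "\<phi> x - \<psi> x" "\<psi> x - \<omega> x"] by simp
  fix v :: 'a assume v: "v \<in> Basis"
  have "norm (disk_deriv \<phi> x v - disk_deriv \<psi> x v) < e" "norm (disk_deriv \<psi> x v - disk_deriv \<omega> x v) < e'"
    using assms x v unfolding C1_disk_close_def by blast+
  then show "norm (disk_deriv \<phi> x v - disk_deriv \<omega> x v) < e + e'"
    using norm_triangle_ineq[of "disk_deriv \<phi> x v - disk_deriv \<psi> x v" "disk_deriv \<psi> x v - disk_deriv \<omega> x v"] by simp
qed

lemma C1_open_blender_disks: "C1_open_disks blender_disks"
  unfolding C1_open_disks_def
proof (intro conjI ballI)
  show "blender_disks \<subseteq> Collect C1_disk_embedding" by (auto simp: blender_disks_def)
  fix \<phi> assume "\<phi> \<in> blender_disks"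
  then obtain e where e: "e < 1/20" "C1_disk_close e \<phi> vertical_disk" unfolding blender_disks_def by blast
  have "\<psi> \<in> blender_disks" if "C1_disk_embedding \<psi>" "C1_disk_close ((1/20 - e) / 2) \<psi> \<phi>" for \<psi>
  proof -
    have "C1_disk_close ((1/20 - e) / 2 + e) \<psi> vertical_disk"
      by (rule C1_disk_close_trans[OF that(2) e(2)])
    moreover have "(1/20 - e) / 2 + e < 1/20" using e(1) by (simp add: field_simps)
    ultimately show ?thesis using that(1) unfolding blender_disks_def by blast
  qed
  moreover have "0 < (1/20 - e) / 2" using e(1) by simp
  ultimately show "\<exists>e>0. \<forall>\<psi>. C1_disk_embedding \<psi> \<and> C1_disk_close e \<psi> \<phi> \<longrightarrow> \<psi> \<in> blender_disks" by blast
qed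

lemma blender_disks_nonempty: "blender_disks \<noteq> {}"
proof -
  have "C1_disk_close (1/40) vertical_disk vertical_disk" by (simp add: C1_disk_close_def)
  then have "vertical_disk \<in> blender_disks"
    unfolding blender_disks_def using C1_disk_embedding_vertical_disk by force
  then show ?thesis by blast
qed

text \<open>The mean value inequality for \<open>\<phi> - vertical_disk\<close> shows that increments of \<open>\<phi>\<close> differ from
  those of the vertical segment, which have speed 13, by a factor of at most \<open>1/20\<close> of the increment of the parameter.\<close>

lemma blender_disk_vertical_curve:
  assumes \<phi>: "\<phi> \<in> blender_disks"
  shows "vertical_curve \<phi> (-1) 1" "\<And>t. t \<in> closed_segment (-1) 1 \<Longrightarrow> \<bar>\<phi> t $ 3 - 10\<bar> \<le> 1/2"
proof -
  let ?S = "cball (0::real) 1"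
  have seg: "closed_segment (-1) (1::real) = ?S" by (auto simp: dist_real_def closed_segment_eq_real_ivl)
  obtain e where e: "e < 1/20" "C1_disk_close e \<phi> vertical_disk" and emb: "C1_disk_embedding \<phi>"
    using \<phi> unfolding blender_disks_def by blast
  have diff: "\<phi> differentiable (at x within ?S)" if "x \<in> ?S" for x
    using emb that unfolding C1_disk_embedding_def by blast
  have inj: "inj_on \<phi> ?S" using emb unfolding C1_disk_embedding_def by blast
  have c0: "norm (\<phi> x - vertical_disk x) \<le> 1/20" if "x \<in> ?S" for x
    using e that unfolding C1_disk_close_def by force
  have c1: "norm (disk_deriv \<phi> x 1 - disk_deriv vertical_disk x 1) \<le> 1/20" if "x \<in> ?S" for x
    using e that unfolding C1_disk_close_def by force
  have lip: "norm ((\<phi> t - vertical_disk t) - (\<phi> t' - vertical_disk t')) \<le> 1/20 * norm (t - t')"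
    if "t \<in> ?S" "t' \<in> ?S" for t t'
  proof (rule differentiable_bound[of ?S "\<lambda>t. \<phi> t - vertical_disk t"
        "\<lambda>x v. disk_deriv \<phi> x v - disk_deriv vertical_disk x v"])
    fix x assume x: "x \<in> ?S"
    have "(\<phi> has_derivative disk_deriv \<phi> x) (at x within ?S)"
      using diff[OF x] unfolding disk_deriv_def by (simp add: frechet_derivative_works)
    moreover have vd: "(vertical_disk has_derivative disk_deriv vertical_disk x) (at x within ?S)"
      unfolding disk_deriv_vertical_disk[OF x] by (rule vertical_disk_has_derivative)
    ultimately show D: "((\<lambda>t. \<phi> t - vertical_disk t) has_derivative
        (\<lambda>v. disk_deriv \<phi> x v - disk_deriv vertical_disk x v)) (at x within ?S)"
      by (rule has_derivative_diff)
    show "onorm (\<lambda>v. disk_deriv \<phi> x v - disk_deriv vertical_disk x v) \<le> 1/20"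
    proof (rule onorm_bound)
      fix v :: real
      have lin: "linear (\<lambda>v. disk_deriv \<phi> x v - disk_deriv vertical_disk x v)"
        using has_derivative_linear[OF D] .
      have "disk_deriv \<phi> x v - disk_deriv vertical_disk x v
          = v *\<^sub>R (disk_deriv \<phi> x 1 - disk_deriv vertical_disk x 1)"
        using linear_cmul[OF lin, of v 1] by simp
      then show "norm (disk_deriv \<phi> x v - disk_deriv vertical_disk x v) \<le> 1/20 * norm v"
        using mult_right_mono[OF c1[OF x], of "\<bar>v\<bar>"] by (simp add: mult.commute)
    qed simp
  qed (use that in auto)
  have comp: "\<bar>(\<phi> x - vertical_disk x) $ i\<bar> \<le> 1/20" if "x \<in> ?S" for x i
    using component_le_norm_cart[of "\<phi> x - vertical_disk x" i] c0[OF that] by linarith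
  have "\<bar>\<phi> t $ 1\<bar> \<le> 1/20" "\<bar>\<phi> t $ 2 - 13 * t\<bar> \<le> 1/20" "\<bar>\<phi> t $ 3 - 10\<bar> \<le> 1/20" if "t \<in> ?S" for t
    using comp[OF that, of 1] comp[OF that, of 2] comp[OF that, of 3] by (simp_all add: vertical_disk_def)
  note pos = this
  show "\<bar>\<phi> t $ 3 - 10\<bar> \<le> 1/2" if "t \<in> closed_segment (-1) 1" for t
    using pos(3)[of t] that unfolding seg by linarith
  show "vertical_curve \<phi> (-1) 1"
    unfolding vertical_curve_def seg
  proof (intro conjI ballI inj)
    show "continuous_on ?S \<phi>"
      using diff by (intro differentiable_imp_continuous_on) (simp add: differentiable_on_def)
    show "\<phi> (-1) $ 2 \<le> -11" "11 \<le> \<phi> 1 $ 2"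
    proof -
      have "\<bar>\<phi> (-1) $ 2 - 13 * (-1)\<bar> \<le> 1/20" "\<bar>\<phi> 1 $ 2 - 13 * 1\<bar> \<le> 1/20" by (intro pos(2), simp)+
      then show "\<phi> (-1) $ 2 \<le> -11" "11 \<le> \<phi> 1 $ 2" by linarith+
    qed
    show "\<bar>\<phi> t $ 1\<bar> \<le> 16" "\<bar>\<phi> t $ 3\<bar> \<le> 12" if "t \<in> ?S" for t
      using pos(1)[OF that] pos(3)[OF that] by linarith+
  next
    fix t t' assume t: "t \<in> ?S" "t' \<in> ?S"
    define r where "r = (\<phi> t - vertical_disk t) - (\<phi> t' - vertical_disk t')"
    have r: "\<bar>r $ i\<bar> \<le> 1/20 * \<bar>t - t'\<bar>" for i
      using component_le_norm_cart[of r i] lip[OF t] unfolding r_def by simp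
    have e: "(\<phi> t - \<phi> t') $ 1 = r $ 1" "(\<phi> t - \<phi> t') $ 2 = r $ 2 + 13 * (t - t')"
      "(\<phi> t - \<phi> t') $ 3 = r $ 3"
      by (simp_all add: r_def vertical_disk_def algebra_simps)
    have "10 * \<bar>r $ 1\<bar> \<le> \<bar>r $ 2 + 13 * (t - t')\<bar>"
      using r[of 1] r[of 2] by linarith
    then show "\<bar>(\<phi> t - \<phi> t') $ 1\<bar> \<le> \<bar>(\<phi> t - \<phi> t') $ 2\<bar> / 10"
      unfolding e by simp
    show "\<bar>(\<phi> t - \<phi> t') $ 3\<bar> \<le> \<bar>(\<phi> t - \<phi> t') $ 2\<bar>"
      unfolding e using r[of 3] r[of 2] by linarith
  qed
qed

lemma blender_disk_meets_local_stable:
  assumes "g \<in> henon_nbhd" "\<phi> \<in> blender_disks"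
  shows "local_stable g 4 (horseshoe g) \<inter> \<phi> ` cball 0 1 \<noteq> {}"
proof -
  have seg: "closed_segment (-1) 1 = cball (0::real) 1"
    by (auto simp: dist_real_def closed_segment_eq_real_ivl)
  obtain t where "t \<in> closed_segment (-1) 1" "\<phi> t \<in> local_stable g 4 (horseshoe g)"
    using vertical_curve_meets_local_stable[OF assms(1) blender_disk_vertical_curve[OF assms(2)]] by blast
  then show ?thesis unfolding seg by blast
qed

section \<open>Neighborhoods and parameters\<close>

lemma Cr_diffeo_mono: "Cr_diffeo r f \<Longrightarrow> s \<le> r \<Longrightarrow> Cr_diffeo s f"
  unfolding Cr_diffeo_def Cr_map_def by (meson le_trans less_le_trans)

lemma Cr_close_mono: "Cr_close r K e f g \<Longrightarrow> s \<le> r \<Longrightarrow> Cr_close s K e f g"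
  unfolding Cr_close_def by (meson le_trans)

lemma Cr_close_trans:
  assumes "Cr_close r K e f g" "Cr_close r K e' g h"
  shows "Cr_close r K (e + e') f h"
  unfolding Cr_close_def
proof (intro ballI impI)
  fix x and vs :: "'a list" assume v: "x \<in> K" "vs \<in> lists Basis" "length vs \<le> r"
  have "norm (iter_deriv vs f x - iter_deriv vs g x) < e" "norm (iter_deriv vs g x - iter_deriv vs h x) < e'"
    using assms v unfolding Cr_close_def by blast+
  then show "norm (iter_deriv vs f x - iter_deriv vs h x) < e + e'"
    using norm_triangle_ineq[of "iter_deriv vs f x - iter_deriv vs g x" "iter_deriv vs g x - iter_deriv vs h x"]
    by simp
qed

lemma cu_henon_close_henon0:
  assumes \<xi>: "\<bar>\<xi> - 3/2\<bar> < 1/10^10" and \<mu>: "\<bar>\<mu> + 100\<bar> < 1/10^10"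
    and \<kappa>: "\<bar>\<kappa>\<bar> < 1/10^10" and \<eta>: "\<bar>\<eta>\<bar> < 1/10^10"
  shows "Cr_close 1 (cball 0 200) (1/40000) (cu_henon \<xi> \<mu> \<kappa> \<eta>) henon0"
proof (rule Cr_close_1I)
  fix p :: "real^3" assume "p \<in> cball 0 200"
  then have p: "\<bar>p $ i\<bar> \<le> 200" for i using component_le_norm_cart[of p i] by simp
  have pp: "\<bar>p $ i * p $ j\<bar> \<le> 200 * 200" for i j
    unfolding abs_mult by (intro mult_mono p) auto
  have small: "\<bar>a * b\<bar> \<le> 1/10^10 * B" if "\<bar>a\<bar> < 1/10^10" "\<bar>b\<bar> \<le> B" for a b B :: real
    unfolding abs_mult using that by (intro mult_mono) auto
  define D where "D = cu_henon \<xi> \<mu> \<kappa> \<eta> p - henon0 p"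
  have "D $ 1 = (\<xi> - 3/2) * p $ 1" "D $ 3 = 0"
    "D $ 2 = (\<mu> + 100) + \<kappa> * (p$1 * p$1) + \<eta> * (p$1 * p$2)"
    by (simp_all add: D_def henon0_def cu_henon_nth algebra_simps power2_eq_square)
  then have "\<bar>D $ 1\<bar> \<le> 1/10^10 * 200" "\<bar>D $ 3\<bar> = 0" "\<bar>D $ 2\<bar> \<le> 1/10^10 + 1/10^10 * (200 * 200) + 1/10^10 * (200 * 200)"
    using small[OF \<xi> p[of 1]] small[OF \<kappa> pp[of 1 1]] small[OF \<eta> pp[of 1 2]] \<mu> by linarith+
  then show "norm (cu_henon \<xi> \<mu> \<kappa> \<eta> p - henon0 p) < 1/40000"
    using norm_vec3_le[of D] unfolding D_def[symmetric] by simp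
  fix b :: "real^3" assume "b \<in> Basis"
  then have b: "\<bar>b $ i\<bar> \<le> 1" for i
    using component_le_norm_cart[of b i] by simp
  have pb: "\<bar>p $ i * b $ j\<bar> \<le> 200 * 1" for i j
    unfolding abs_mult by (intro mult_mono p b) auto
  define E where "E = frechet_derivative (cu_henon \<xi> \<mu> \<kappa> \<eta>) (at p) b - frechet_derivative henon0 (at p) b"
  have fd: "frechet_derivative (cu_henon \<xi> \<mu> \<kappa> \<eta>) (at p) = (\<lambda>v. vector [\<xi> * v$1 + v$2,
      (2 * \<kappa> * p$1 + \<eta> * p$2) * v$1 + (2 * p$2 + \<eta> * p$1) * v$2, v$2])"
    by (rule frechet_derivative_at[OF cu_henon_has_derivative, symmetric])
  have "E $ 1 = (\<xi> - 3/2) * b $ 1" "E $ 3 = 0"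
    "E $ 2 = 2 * (\<kappa> * (p$1 * b$1)) + \<eta> * (p$2 * b$1) + \<eta> * (p$1 * b$2)"
    by (simp_all add: E_def fd henon0_derivative algebra_simps)
  then have "\<bar>E $ 1\<bar> \<le> 1/10^10 * 1" "\<bar>E $ 3\<bar> = 0" "\<bar>E $ 2\<bar> \<le> 4 * (1/10^10 * (200 * 1))"
    using small[OF \<xi> b[of 1]] small[OF \<kappa> pb[of 1 1]] small[OF \<eta> pb[of 2 1]] small[OF \<eta> pb[of 1 2]]
    by linarith+
  then show "norm (frechet_derivative (cu_henon \<xi> \<mu> \<kappa> \<eta>) (at p) b - frechet_derivative henon0 (at p) b) < 1/40000"
    using norm_vec3_le[of E] unfolding E_def[symmetric] by simp
qed

text \<open>Half of the radius of the fixed neighborhood is kept in reserve, so that one and the same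
  neighborhood serves for every such map.\<close>

lemma henon_nbhd_C1_nhd:
  assumes F: "Cr_diffeo 1 F" "Cr_close 1 (cball 0 200) (1/20000) F henon0"
  shows "C1_nhd F henon_nbhd"
  unfolding C1_nhd_def
proof (intro conjI exI allI impI)
  show "henon_nbhd \<subseteq> Collect (Cr_diffeo 1)" by (auto simp: henon_nbhd_def)
  show "compact (cball (0::real^3) 200)" "(0::real) < 1/20000" by simp_all
  fix g assume g: "Cr_diffeo 1 g \<and> Cr_close 1 (cball 0 200) (1/20000) g F"
  then have "Cr_close 1 (cball 0 200) (1/20000 + 1/20000) g henon0"
    using F(2) Cr_close_trans by blast
  then show "g \<in> henon_nbhd" using g by (simp add: henon_nbhd_def)
qed

text \<open>As a function of the map, \<open>horseshoe\<close> is the hyperbolic continuation on all of \<open>henon_nbhd\<close>.\<close>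

lemma henon_nbhd_blender:
  assumes F: "F \<in> henon_nbhd" "C1_nhd F henon_nbhd"
  shows "cu_blender TYPE(real) F (horseshoe F)"
  unfolding cu_blender_def
proof (intro conjI)
  show "Cr_diffeo 1 F" using F(1) by (simp add: henon_nbhd_def)
  show "hyperbolic_set F (horseshoe F)" "transitive_set F (horseshoe F)"
    by (fact horseshoe_hyperbolic(1)[OF F(1)] horseshoe_transitive[OF F(1)])+
  show "has_index F (horseshoe F) (DIM(real) + 1)" using horseshoe_hyperbolic(2)[OF F(1)] by (simp add: numeral_2_eq_2)
  have "hyperbolic_continuation F (horseshoe F) henon_nbhd horseshoe"
    unfolding hyperbolic_continuation_def
    using horseshoe_hyperbolic(1) horseshoe_conjugate_copy[OF F(1)] horseshoe_conjugate_copy_unique[OF F(1)]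
    by (intro exI[of _ 1]) auto
  then show "\<exists>U L e (\<D> :: (real \<Rightarrow> real^3) set).
        C1_nhd F U \<and> hyperbolic_continuation F (horseshoe F) U L \<and> C1_open_disks \<D> \<and> \<D> \<noteq> {} \<and>
        (\<forall>g\<in>U. stable_size g e (L g) \<and> (\<forall>\<phi>\<in>\<D>. local_stable g e (L g) \<inter> \<phi> ` cball 0 1 \<noteq> {}))"
    using F(2) C1_open_blender_disks blender_disks_nonempty horseshoe_stable_size blender_disk_meets_local_stable
    by (intro exI[of _ henon_nbhd] exI[of _ horseshoe] exI[of _ "4::real"] exI[of _ blender_disks]) auto
qed

theorem theorem1p1:
  fixes r :: nat
  assumes "r \<ge> 1"
  shows "\<exists>B :: (real \<times> real \<times> real \<times> real) set.
    open B \<and> B \<noteq> {} \<and>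
    (\<forall>(\<xi>, \<mu>, \<kappa>, \<eta>) \<in> B. \<xi> > 1 \<and>
      (\<exists>K e. compact K \<and> e > 0 \<and>
        (\<forall>F :: real^3 \<Rightarrow> real^3.
          Cr_diffeo r F \<and> Cr_close r K e F (cu_henon \<xi> \<mu> \<kappa> \<eta>) \<longrightarrow> has_blender F)))"
proof -
  define I where "I c = {c - 1/10^10 <..< c + 1/10^10}" for c :: real
  define B where "B = I (3/2) \<times> I (-100) \<times> I 0 \<times> I 0"
  have "open B" unfolding B_def I_def by (intro open_Times open_greaterThanLessThan)
  moreover have "(3/2, -100, 0, 0) \<in> B" by (simp add: B_def I_def)
  moreover have "\<xi> > 1 \<and> (\<exists>K e. compact K \<and> e > 0 \<and>
        (\<forall>F :: real^3 \<Rightarrow> real^3.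
          Cr_diffeo r F \<and> Cr_close r K e F (cu_henon \<xi> \<mu> \<kappa> \<eta>) \<longrightarrow> has_blender F))"
    if "(\<xi>, \<mu>, \<kappa>, \<eta>) \<in> B" for \<xi> \<mu> \<kappa> \<eta>
  proof (intro conjI exI allI impI)
    have p: "\<bar>\<xi> - 3/2\<bar> < 1/10^10" "\<bar>\<mu> + 100\<bar> < 1/10^10" "\<bar>\<kappa>\<bar> < 1/10^10" "\<bar>\<eta>\<bar> < 1/10^10"
      using that unfolding B_def I_def mem_Times_iff fst_conv snd_conv greaterThanLessThan_iff by linarith+
    have "\<bar>\<xi> - 3/2\<bar> < 1/2" using p(1) by (rule less_trans) simp
    then show "\<xi> > 1" by linarith
    show "compact (cball (0::real^3) 200)" "(0::real) < 1/40000" by simp_all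
    fix F :: "real^3 \<Rightarrow> real^3"
    assume F: "Cr_diffeo r F \<and> Cr_close r (cball 0 200) (1/40000) F (cu_henon \<xi> \<mu> \<kappa> \<eta>)"
    have F1: "Cr_diffeo 1 F" using Cr_diffeo_mono F assms by blast
    have "Cr_close 1 (cball 0 200) (1/40000) F (cu_henon \<xi> \<mu> \<kappa> \<eta>)"
      using Cr_close_mono F assms by blast
    then have "Cr_close 1 (cball 0 200) (1/40000 + 1/40000) F henon0"
      using cu_henon_close_henon0[OF p] by (rule Cr_close_trans)
    then have F2: "Cr_close 1 (cball 0 200) (1/20000) F henon0" by simp
    have "C1_nhd F henon_nbhd" by (rule henon_nbhd_C1_nhd[OF F1 F2])
    moreover have "F \<in> henon_nbhd"
      using F1 F2 unfolding henon_nbhd_def Cr_close_def by force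
    ultimately show "has_blender F" unfolding has_blender_def using henon_nbhd_blender by blast
  qed
  ultimately show ?thesis by (intro exI[of _ B]) auto
qed

end
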